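(* Let $G$ be an 8-dimensional Riemannian Lie group containing $K=\mathbf{SU}(2)\times\mathbf{SU}(2)$ as a Lie subgroup, where $K$ carries the standard Riemannian metric induced by its Killing form, whose Lie algebra $\mathfrak g$ has the orthonormal basis $\{A,B,C,R,S,T,X,Y\}$ and the Lie bracket relations written out in the context, with real coefficients $\rho,b_{11},b_{21},c_{11},c_{12},c_{21},c_{22},s_{14},s_{24},t_{14},t_{15},t_{24},t_{25}$. Let $(\lambda_j,\mu_j,\nu_j)\in\mathbb R^3$ with $\lambda_j^2+\mu_j^2+\nu_j^2=1$ for $j=1,2$, assume $\lambda_1\neq 0$ and $\lambda_2\neq 0$, and let $J$ be the left-invariant almost Hermitian structure on $G$ given by the matrix in the context. Then $J$ is integrable if and only if $$c_{11}=\frac{\lambda_1^2+\mu_1^2}{\lambda_1}b_{21}+\frac{\mu_1}{\lambda_1}c_{12}-\frac{\mu_1\nu_1}{\lambda_1}c_{21}-\nu_1c_{22},$$ $$b_{11}=\frac{\mu_1\nu_1}{\lambda_1}b_{21}+\frac{\nu_1}{\lambda_1}c_{12}-\frac{\lambda_1^2+\nu_1^2}{\lambda_1}c_{21}+\mu_1c_{22},$$ $$t_{14}=\frac{\lambda_2^2+\mu_2^2}{\lambda_2}s_{24}+\frac{\mu_2}{\lambda_2}t_{15}-\frac{\mu_2\nu_2}{\lambda_2}t_{24}-\nu_2t_{25},$$ $$s_{14}=\frac{\mu_2\nu_2}{\lambda_2}s_{24}+\frac{\nu_2}{\lambda_2}t_{15}-\frac{\lambda_2^2+\nu_2^2}{\lambda_2}t_{24}+\mu_2t_{25},$$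 where $b_{21},c_{12},c_{21},c_{22},s_{24},t_{15},t_{24},t_{25}$ are arbitrary real numbers.
   Context: The Lie algebra $\mathfrak g$ of $G$ is identified with the left-invariant vector fields; the left-invariant metric $g$ on $G$ is the one for which $\{A,B,C,R,S,T,X,Y\}$ is orthonormal. The subalgebra $\mathfrak{su}(2)\oplus\mathfrak{su}(2)$ of $K$ is spanned by $A,B,C,R,S,T$, with $[A,B]=2C$, $[B,C]=2A$, $[C,A]=2B$, $[R,S]=2T$, $[S,T]=2R$, $[T,R]=2S$, and each of $A,B,C$ commutes with each of $R,S,T$. The remaining brackets are $$[A,X]=-b_{11}B-c_{11}C,\quad [A,Y]=-b_{21}B-c_{21}C,$$ $$[B,X]=b_{11}A-c_{12}C,\quad [B,Y]=b_{21}A-c_{22}C,$$ $$[C,X]=c_{11}A+c_{12}B,\quad [C,Y]=c_{21}A+c_{22}B,$$ $$[R,X]=-s_{14}S-t_{14}T,\quad [R,Y]=-s_{24}S-t_{24}T,$$ $$[S,X]=s_{14}R-t_{15}T,\quad [S,Y]=s_{24}R-t_{25}T,$$ $$[T,X]=t_{14}R+t_{15}S,\quad [T,Y]=t_{24}R+t_{25}S,$$ $$[X,Y]=\rho X+\theta_1A+\theta_2B+\theta_3C+\theta_4R+\theta_5S+\theta_6T,$$ where $$2\theta_1=-\rho c_{12}+b_{11}c_{21}-b_{21}c_{11},\quad 2\theta_2=\rho c_{11}+b_{11}c_{22}-b_{21}c_{12},\quad 2\theta_3=-\rho b_{11}+c_{11}c_{22}-c_{12}c_{21},$$ $$2\theta_4=-\rho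 t_{15}+s_{14}t_{24}-s_{24}t_{14},\quad 2\theta_5=\rho t_{14}+s_{14}t_{25}-s_{24}t_{15},\quad 2\theta_6=-\rho s_{14}+t_{14}t_{25}-t_{15}t_{24}.$$ The 13 coefficients $\rho,b_{jk},c_{jk},s_{jk},t_{jk}$ may be arbitrary real numbers (the Jacobi identity then holds). In the ordered basis $(A,B,C,R,S,T,X,Y)$, acting on column vectors of coordinates, $J$ is the matrix $$\begin{pmatrix} 0&\nu_1&\mu_1&\lambda_1\lambda_2&-\lambda_1\mu_2&\lambda_1\nu_2&0&0\\ -\nu_1&0&\lambda_1&-\mu_1\lambda_2&\mu_1\mu_2&-\mu_1\nu_2&0&0\\ -\mu_1&-\lambda_1&0&\nu_1\lambda_2&-\nu_1\mu_2&\nu_1\nu_2&0&0\\ -\lambda_1\lambda_2&\mu_1\lambda_2&-\nu_1\lambda_2&0&\nu_2&\mu_2&0&0\\ \lambda_1\mu_2&-\mu_1\mu_2&\nu_1\mu_2&-\nu_2&0&\lambda_2&0&0\\ -\lambda_1\nu_2&\mu_1\nu_2&-\nu_1\nu_2&-\mu_2&-\lambda_2&0&0&0\\ 0&0&0&0&0&0&0&-1\\ 0&0&0&0&0&0&1&0 \end{pmatrix},$$ extended to $G$ by left translation; it satisfies $J^2=-\mathrm{id}$ and $g(JE,JF)=g(E,F)$. $J$ is integrable if it is induced by a complex manifold structure; equivalently (Newlander–Nirenberg) the Nijenhuis tensor $N_J(E,F)=[E,F]+J[JE,F]+J[E,JF]-[JE,JF]$ vanishes, which for left-invariant $J$ is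 equivalent to its vanishing on all $E,F\in\mathfrak g$. *)

theory Defs
  imports
    "HOL-Analysis.Analysis"
    "HOL-Library.Function_Algebras"
    "HOL-Algebra.Group"
begin

instantiation "fun" :: (type, real_vector) real_vector
begin

definition scaleR_fun :: "real \<Rightarrow> ('a \<Rightarrow> 'b) \<Rightarrow> 'a \<Rightarrow> 'b" where
  "scaleR_fun a f = (\<lambda>x. a *\<^sub>R f x)"

instance
  by standard (simp_all add: scaleR_fun_def fun_eq_iff scaleR_add_right scaleR_add_left)

end


section \<open>Smoothness on open subsets of Euclidean spaces\<close>

primrec ck_on :: "nat \<Rightarrow> 'a::real_normed_vector set \<Rightarrow> ('a \<Rightarrow> 'b::real_normed_vector) \<Rightarrow> bool" where
  "ck_on 0 S f \<longleftrightarrow> continuous_on S f"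
| "ck_on (Suc k) S f \<longleftrightarrow> (\<forall>x\<in>S. f differentiable (at x)) \<and>
     (\<forall>v. ck_on k S (\<lambda>x. frechet_derivative f (at x) v))"

definition smooth_on :: "'a::real_normed_vector set \<Rightarrow> ('a \<Rightarrow> 'b::real_normed_vector) \<Rightarrow> bool" where
  "smooth_on S f \<longleftrightarrow> (\<forall>k. ck_on k S f)"


section \<open>Smooth manifolds\<close>

text \<open>
  A manifold is a Hausdorff, second countable type \<open>'m\<close> together with a smooth atlas modelled on
  the Euclidean space \<open>'e\<close>, whose dimension is the dimension of the manifold. A chart is an open
  domain together with a coordinate map, whose values outside the domain are irrelevant.
\<close>

type_synonym ('m, 'e) chart = "'m set \<times> ('m \<Rightarrow> 'e)"

definition chart_inv :: "('m, 'e) chart \<Rightarrow> 'e \<Rightarrow> 'm" where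
  "chart_inv c = inv_into (fst c) (snd c)"

definition smooth_atlas ::
    "('m::topological_space, 'e::euclidean_space) chart set \<Rightarrow> bool" where
  "smooth_atlas \<A> \<longleftrightarrow>
     (\<forall>c\<in>\<A>. open (fst c) \<and> open (snd c ` fst c) \<and>
        homeomorphism (fst c) (snd c ` fst c) (snd c) (chart_inv c)) \<and>
     (\<Union>c\<in>\<A>. fst c) = UNIV \<and>
     (\<forall>c\<in>\<A>. \<forall>d\<in>\<A>. smooth_on (snd c ` (fst c \<inter> fst d)) (snd d \<circ> chart_inv c))"

definition prod_atlas ::
    "('m, 'e) chart set \<Rightarrow> ('n, 'f) chart set \<Rightarrow> ('m \<times> 'n, 'e \<times> 'f) chart set" where
  "prod_atlas \<A> \<B> = {(fst c \<times> fst d, map_prod (snd c) (snd d)) | c d. c \<in> \<A> \<and> d \<in> \<B>}"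

definition smooth_map ::
    "('m::topological_space, 'e::euclidean_space) chart set \<Rightarrow>
     ('n::topological_space, 'f::euclidean_space) chart set \<Rightarrow> ('m \<Rightarrow> 'n) \<Rightarrow> bool" where
  "smooth_map \<A> \<B> F \<longleftrightarrow> continuous_on UNIV F \<and>
     (\<forall>c\<in>\<A>. \<forall>d\<in>\<B>. smooth_on (snd c ` (fst c \<inter> F -` fst d)) (snd d \<circ> F \<circ> chart_inv c))"

definition smooth_fun ::
    "('m::topological_space, 'e::euclidean_space) chart set \<Rightarrow> ('m \<Rightarrow> real) \<Rightarrow> bool" where
  "smooth_fun \<A> f \<longleftrightarrow> (\<forall>c\<in>\<A>. smooth_on (snd c ` fst c) (f \<circ> chart_inv c))"

text \<open>
  A tangent vector at \<open>p\<close> is the family of its component vectors in all charts around \<open>p\<close>,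
  subject to the transformation law; the components in the remaining charts are set to \<open>0\<close>,
  so that tangent vectors are determined by their meaningful components.
\<close>

type_synonym ('m, 'e) tangent = "('m, 'e) chart \<Rightarrow> 'e"

type_synonym ('m, 'e) vfield = "'m \<Rightarrow> ('m, 'e) tangent"

definition tangent_space ::
    "('m, 'e::euclidean_space) chart set \<Rightarrow> 'm \<Rightarrow> ('m, 'e) tangent set" where
  "tangent_space \<A> p = {v.
     (\<forall>c. \<not> (c \<in> \<A> \<and> p \<in> fst c) \<longrightarrow> v c = 0) \<and>
     (\<forall>c\<in>\<A>. \<forall>d\<in>\<A>. p \<in> fst c \<and> p \<in> fst d \<longrightarrow>
        v d = frechet_derivative (snd d \<circ> chart_inv c) (at (snd c p)) (v c))}"

text \<open>
  The differential of \<open>F\<close> at \<open>p\<close>. By the transformation law it does not depend on the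
  chart chosen around \<open>p\<close>.
\<close>

definition differential ::
    "('m, 'e::euclidean_space) chart set \<Rightarrow> ('n, 'f::euclidean_space) chart set \<Rightarrow>
     ('m \<Rightarrow> 'n) \<Rightarrow> 'm \<Rightarrow> ('m, 'e) tangent \<Rightarrow> ('n, 'f) tangent" where
  "differential \<A> \<B> F p v = (\<lambda>d.
     if d \<in> \<B> \<and> F p \<in> fst d
     then let c = (SOME c. c \<in> \<A> \<and> p \<in> fst c)
          in frechet_derivative (snd d \<circ> F \<circ> chart_inv c) (at (snd c p)) (v c)
     else 0)"

definition vector_field :: "('m, 'e::euclidean_space) chart set \<Rightarrow> ('m, 'e) vfield \<Rightarrow> bool" where
  "vector_field \<A> V \<longleftrightarrow> (\<forall>p. V p \<in> tangent_space \<A> p) \<and>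
     (\<forall>c\<in>\<A>. smooth_on (snd c ` fst c) (\<lambda>x. V (chart_inv c x) c))"

text \<open>
  The Lie bracket \<open>[V, W] = V W - W V\<close>, whose components in a chart are
  \<open>(V \<cdot> \<partial>) W - (W \<cdot> \<partial>) V\<close>.
\<close>

definition lie_bracket ::
    "('m, 'e::euclidean_space) chart set \<Rightarrow> ('m, 'e) vfield \<Rightarrow> ('m, 'e) vfield \<Rightarrow> ('m, 'e) vfield" where
  "lie_bracket \<A> V W = (\<lambda>p c.
     if c \<in> \<A> \<and> p \<in> fst c
     then frechet_derivative (\<lambda>x. W (chart_inv c x) c) (at (snd c p)) (V p c)
        - frechet_derivative (\<lambda>x. V (chart_inv c x) c) (at (snd c p)) (W p c)
     else 0)"

definition riemannian_metric ::
    "('m::topological_space, 'e::euclidean_space) chart set \<Rightarrow>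
     ('m \<Rightarrow> ('m, 'e) tangent \<Rightarrow> ('m, 'e) tangent \<Rightarrow> real) \<Rightarrow> bool" where
  "riemannian_metric \<A> g \<longleftrightarrow>
     (\<forall>p. \<forall>u\<in>tangent_space \<A> p. \<forall>v\<in>tangent_space \<A> p. \<forall>w\<in>tangent_space \<A> p. \<forall>a.
        g p (u + v) w = g p u w + g p v w \<and> g p (a *\<^sub>R u) w = a * g p u w \<and>
        g p u v = g p v u \<and> (u \<noteq> 0 \<longrightarrow> 0 < g p u u)) \<and>
     (\<forall>V W. vector_field \<A> V \<and> vector_field \<A> W \<longrightarrow> smooth_fun \<A> (\<lambda>p. g p (V p) (W p)))"


section \<open>Almost complex structures\<close>

definition apply_field ::
    "('m \<Rightarrow> ('m, 'e) tangent \<Rightarrow> ('m, 'e) tangent) \<Rightarrow> ('m, 'e) vfield \<Rightarrow> ('m, 'e) vfield" where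
  "apply_field J V = (\<lambda>p. J p (V p))"

definition almost_complex ::
    "('m, 'e::euclidean_space) chart set \<Rightarrow> ('m \<Rightarrow> ('m, 'e) tangent \<Rightarrow> ('m, 'e) tangent) \<Rightarrow> bool" where
  "almost_complex \<A> J \<longleftrightarrow>
     (\<forall>p. \<forall>u\<in>tangent_space \<A> p. \<forall>v\<in>tangent_space \<A> p. \<forall>a.
        J p u \<in> tangent_space \<A> p \<and> J p (u + v) = J p u + J p v \<and>
        J p (a *\<^sub>R u) = a *\<^sub>R J p u \<and> J p (J p u) = - u) \<and>
     (\<forall>V. vector_field \<A> V \<longrightarrow> vector_field \<A> (apply_field J V))"

definition almost_hermitian ::
    "('m, 'e::euclidean_space) chart set \<Rightarrow>
     ('m \<Rightarrow> ('m, 'e) tangent \<Rightarrow> ('m, 'e) tangent \<Rightarrow> real) \<Rightarrow>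
     ('m \<Rightarrow> ('m, 'e) tangent \<Rightarrow> ('m, 'e) tangent) \<Rightarrow> bool" where
  "almost_hermitian \<A> g J \<longleftrightarrow> almost_complex \<A> J \<and>
     (\<forall>p. \<forall>u\<in>tangent_space \<A> p. \<forall>v\<in>tangent_space \<A> p. g p (J p u) (J p v) = g p u v)"

definition nijenhuis ::
    "('m, 'e::euclidean_space) chart set \<Rightarrow> ('m \<Rightarrow> ('m, 'e) tangent \<Rightarrow> ('m, 'e) tangent) \<Rightarrow>
     ('m, 'e) vfield \<Rightarrow> ('m, 'e) vfield \<Rightarrow> ('m, 'e) vfield" where
  "nijenhuis \<A> J E F =
     lie_bracket \<A> E F
     + apply_field J (lie_bracket \<A> (apply_field J E) F)
     + apply_field J (lie_bracket \<A> E (apply_field J F))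
     - lie_bracket \<A> (apply_field J E) (apply_field J F)"

text \<open>
  Integrability in the sense of the Newlander--Nirenberg criterion: the Nijenhuis tensor vanishes
  on all smooth vector fields of the manifold, not just on left-invariant ones.
\<close>

definition integrable_structure ::
    "('m, 'e::euclidean_space) chart set \<Rightarrow> ('m \<Rightarrow> ('m, 'e) tangent \<Rightarrow> ('m, 'e) tangent) \<Rightarrow> bool" where
  "integrable_structure \<A> J \<longleftrightarrow>
     (\<forall>E F. vector_field \<A> E \<and> vector_field \<A> F \<longrightarrow> nijenhuis \<A> J E F = 0)"


section \<open>Lie groups\<close>

definition lie_group ::
    "('g::{t2_space,second_countable_topology}, 'e::euclidean_space) chart set \<Rightarrow> 'g monoid \<Rightarrow> bool" where
  "lie_group \<A> G \<longleftrightarrow> smooth_atlas \<A> \<and> Group.group G \<and> carrier G = UNIV \<and>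
     smooth_map (prod_atlas \<A> \<A>) \<A> (\<lambda>(p, q). p \<otimes>\<^bsub>G\<^esub> q) \<and>
     smooth_map \<A> \<A> (\<lambda>p. inv\<^bsub>G\<^esub> p)"

definition left_diff ::
    "('g, 'e::euclidean_space) chart set \<Rightarrow> 'g monoid \<Rightarrow> 'g \<Rightarrow> 'g \<Rightarrow> ('g, 'e) tangent \<Rightarrow> ('g, 'e) tangent" where
  "left_diff \<A> G h p = differential \<A> \<A> (\<lambda>q. h \<otimes>\<^bsub>G\<^esub> q) p"

definition lie_algebra ::
    "('g, 'e::euclidean_space) chart set \<Rightarrow> 'g monoid \<Rightarrow> ('g, 'e) vfield set" where
  "lie_algebra \<A> G = {V. vector_field \<A> V \<and> (\<forall>h p. V (h \<otimes>\<^bsub>G\<^esub> p) = left_diff \<A> G h p (V p))}"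

definition left_invariant_metric ::
    "('g, 'e::euclidean_space) chart set \<Rightarrow> 'g monoid \<Rightarrow>
     ('g \<Rightarrow> ('g, 'e) tangent \<Rightarrow> ('g, 'e) tangent \<Rightarrow> real) \<Rightarrow> bool" where
  "left_invariant_metric \<A> G g \<longleftrightarrow>
     (\<forall>h p. \<forall>u\<in>tangent_space \<A> p. \<forall>v\<in>tangent_space \<A> p.
        g (h \<otimes>\<^bsub>G\<^esub> p) (left_diff \<A> G h p u) (left_diff \<A> G h p v) = g p u v)"

definition riemannian_lie_group ::
    "('g::{t2_space,second_countable_topology}, 'e::euclidean_space) chart set \<Rightarrow> 'g monoid \<Rightarrow>
     ('g \<Rightarrow> ('g, 'e) tangent \<Rightarrow> ('g, 'e) tangent \<Rightarrow> real) \<Rightarrow> bool" where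
  "riemannian_lie_group \<A> G g \<longleftrightarrow>
     lie_group \<A> G \<and> riemannian_metric \<A> g \<and> left_invariant_metric \<A> G g"

definition left_invariant_endo ::
    "('g, 'e::euclidean_space) chart set \<Rightarrow> 'g monoid \<Rightarrow>
     ('g \<Rightarrow> ('g, 'e) tangent \<Rightarrow> ('g, 'e) tangent) \<Rightarrow> bool" where
  "left_invariant_endo \<A> G J \<longleftrightarrow>
     (\<forall>h p. \<forall>u\<in>tangent_space \<A> p.
        J (h \<otimes>\<^bsub>G\<^esub> p) (left_diff \<A> G h p u) = left_diff \<A> G h p (J p u))"

definition orthonormal_basis_of_lie_algebra ::
    "('g, 'e::euclidean_space) chart set \<Rightarrow> 'g monoid \<Rightarrow>
     ('g \<Rightarrow> ('g, 'e) tangent \<Rightarrow> ('g, 'e) tangent \<Rightarrow> real) \<Rightarrow> ('g, 'e) vfield list \<Rightarrow> bool" where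
  "orthonormal_basis_of_lie_algebra \<A> G g es \<longleftrightarrow>
     span (set es) = lie_algebra \<A> G \<and>
     (\<forall>i<length es. \<forall>j<length es. \<forall>p. g p ((es ! i) p) ((es ! j) p) = (if i = j then 1 else 0))"

text \<open>The \<open>j\<close>-th column of \<open>M\<close> (a list of rows) holds the coordinates of the image of the \<open>j\<close>-th basis field.\<close>

definition has_matrix ::
    "('m \<Rightarrow> ('m, 'e::euclidean_space) tangent \<Rightarrow> ('m, 'e) tangent) \<Rightarrow> ('m, 'e) vfield list \<Rightarrow>
     real list list \<Rightarrow> bool" where
  "has_matrix J es M \<longleftrightarrow>
     (\<forall>j<length es. apply_field J (es ! j) = (\<Sum>i<length es. (M ! i ! j) *\<^sub>R (es ! i)))"


section \<open>The subgroup \<open>SU(2) \<times> SU(2)\<close>\<close>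

definition SU2 :: "(complex^2^2) monoid" where
  "SU2 = \<lparr>carrier = {U. U ** (\<chi> i j. cnj (U $ j $ i)) = mat 1 \<and> det U = 1},
          mult = (\<lambda>U V. U ** V), one = mat 1\<rparr>"

text \<open>Smoothness of a map defined on an embedded submanifold \<open>S\<close> of a Euclidean space: locally,
  it is the restriction of a smooth map of the ambient space.\<close>

definition smooth_from_subset ::
    "'a::euclidean_space set \<Rightarrow> ('g, 'e::euclidean_space) chart set \<Rightarrow> ('a \<Rightarrow> 'g) \<Rightarrow> bool" where
  "smooth_from_subset S \<A> \<Phi> \<longleftrightarrow>
     (\<forall>x\<in>S. \<forall>c\<in>\<A>. \<Phi> x \<in> fst c \<longrightarrow>
        (\<exists>W F. open W \<and> x \<in> W \<and> smooth_on W F \<and>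
           (\<forall>y\<in>S \<inter> W. \<Phi> y \<in> fst c \<and> snd c (\<Phi> y) = F y)))"

text \<open>The inclusion of a group \<open>K\<close> of matrices (or pairs of matrices) as a Lie subgroup of \<open>G\<close>.
  An injective smooth homomorphism of Lie groups is automatically an immersion.\<close>

definition lie_subgroup_inclusion ::
    "('g, 'e::euclidean_space) chart set \<Rightarrow> 'g monoid \<Rightarrow> 'a::euclidean_space monoid \<Rightarrow> ('a \<Rightarrow> 'g) \<Rightarrow> bool" where
  "lie_subgroup_inclusion \<A> G K \<Phi> \<longleftrightarrow> \<Phi> \<in> mon K G \<and> smooth_from_subset (carrier K) \<A> \<Phi>"

text \<open>The Lie algebra of \<open>\<Phi> ` carrier K\<close> inside that of \<open>G\<close>: those left-invariant fields whose
  value at the identity is the velocity of a curve in the subgroup.\<close>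

definition subgroup_lie_algebra ::
    "('g, 'e::euclidean_space) chart set \<Rightarrow> 'g monoid \<Rightarrow> 'a::euclidean_space monoid \<Rightarrow> ('a \<Rightarrow> 'g) \<Rightarrow>
     ('g, 'e) vfield set" where
  "subgroup_lie_algebra \<A> G K \<Phi> = {V \<in> lie_algebra \<A> G.
     \<exists>\<gamma>. \<gamma> (0::real) = \<one>\<^bsub>K\<^esub> \<and> range \<gamma> \<subseteq> carrier K \<and> \<gamma> differentiable (at 0) \<and>
       (\<forall>c\<in>\<A>. \<one>\<^bsub>G\<^esub> \<in> fst c \<longrightarrow>
          ((\<lambda>t. snd c (\<Phi> (\<gamma> t))) has_vector_derivative V \<one>\<^bsub>G\<^esub> c) (at 0))}"

text \<open>The trace of \<open>ad U \<circ> ad V\<close> on the finite-dimensional Lie algebra \<open>\<kk>\<close>, computed in an arbitrary basis.\<close>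

definition killing_form ::
    "('m, 'e::euclidean_space) chart set \<Rightarrow> ('m, 'e) vfield set \<Rightarrow> ('m, 'e) vfield \<Rightarrow> ('m, 'e) vfield \<Rightarrow> real" where
  "killing_form \<A> \<kk> U V =
     (let B = (SOME B. independent B \<and> span B = \<kk>)
      in \<Sum>b\<in>B. representation B (lie_bracket \<A> U (lie_bracket \<A> V b)) b)"

text \<open>The metric induced on the subgroup is a negative multiple of its (negative definite) Killing
  form. The factor is left open here, as its normalization is a matter of convention.\<close>

definition carries_killing_metric ::
    "('g, 'e::euclidean_space) chart set \<Rightarrow> 'g monoid \<Rightarrow>
     ('g \<Rightarrow> ('g, 'e) tangent \<Rightarrow> ('g, 'e) tangent \<Rightarrow> real) \<Rightarrow>
     'a::euclidean_space monoid \<Rightarrow> ('a \<Rightarrow> 'g) \<Rightarrow> bool" where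
  "carries_killing_metric \<A> G g K \<Phi> \<longleftrightarrow>
     (let \<kk> = subgroup_lie_algebra \<A> G K \<Phi>
      in \<exists>\<kappa>>0. \<forall>U\<in>\<kk>. \<forall>V\<in>\<kk>. \<forall>p\<in>\<Phi> ` carrier K.
           g p (U p) (V p) = - \<kappa> * killing_form \<A> \<kk> U V)"

end

theory Submission
  imports Defs
begin

text \<open>
  The Nijenhuis tensor \<open>N\<close> is skew, bilinear over functions and satisfies \<open>N(JE, F) = -J N(E, F)\<close>,
  so it vanishes on all vector fields as soon as it vanishes on a global frame; the orthonormal
  basis is such a frame, with coefficient functions \<open>g(V, e\<^sub>i)\<close>. It vanishes identically on
  \<open>su(2) \<oplus> su(2)\<close>, and \<open>Y = JX\<close>, so only the vectors \<open>N(X, e)\<close> with \<open>e\<close> in \<open>su(2) \<oplus> su(2)\<close>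
  remain. Their coordinates are combinations of \<open>p1, p2, p3\<close> (for the first factor) and
  \<open>q1, q2, q3\<close> (for the second), where \<open>\<lambda>\<^sub>1 p3 = -\<nu>\<^sub>1 p1 - \<mu>\<^sub>1 p2\<close> and likewise for \<open>q3\<close>. Finally
  \<open>p1 = p2 = 0\<close> is a linear system for \<open>b11, c11\<close> with determinant \<open>\<lambda>\<^sub>1\<^sup>2\<close>.
\<close>

section \<open>Differentiable functions and vector fields\<close>

lemmas fun_apply_simps = plus_fun_apply zero_fun_apply minus_apply uminus_apply

text \<open>
  On \<open>vfield\<close>, a function type with values in a function type, the pointwise rules
  would also expand the tangent vectors; \<open>vfield_apply\<close> stops after one argument.
\<close>

declare fun_apply_simps [simp del]

lemma vfield_apply:
  fixes V W :: "('m, 'e::euclidean_space) vfield"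
  shows "(V + W) p = V p + W p" "(V - W) p = V p - W p" "(- V) p = - V p" "(0 :: ('m, 'e) vfield) p = 0"
  by (simp_all only: fun_apply_simps)

text \<open>One derivative is all that the bracket and the Leibniz rule consume. At this level of
  regularity, closure of fields under sums and under multiplication by functions follows at once
  from the sum and product rules.\<close>

definition diff_fun :: "('m, 'e::euclidean_space) chart set \<Rightarrow> ('m \<Rightarrow> real) \<Rightarrow> bool" where
  "diff_fun \<A> f \<longleftrightarrow> (\<forall>c\<in>\<A>. \<forall>p\<in>fst c. (\<lambda>x. f (chart_inv c x)) differentiable (at (snd c p)))"

definition diff_field :: "('m, 'e::euclidean_space) chart set \<Rightarrow> ('m, 'e) vfield \<Rightarrow> bool" where
  "diff_field \<A> V \<longleftrightarrow> (\<forall>p. V p \<in> tangent_space \<A> p) \<and>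
     (\<forall>c\<in>\<A>. \<forall>p\<in>fst c. (\<lambda>x. V (chart_inv c x) c) differentiable (at (snd c p)))"

definition fscale :: "('m \<Rightarrow> real) \<Rightarrow> ('m, 'e::euclidean_space) vfield \<Rightarrow> ('m, 'e) vfield" where
  "fscale f V = (\<lambda>p. f p *\<^sub>R V p)"

text \<open>The chart is irrelevant by \<open>dir_deriv_chart\<close> below.\<close>

definition dir_deriv ::
    "('m, 'e::euclidean_space) chart set \<Rightarrow> ('m, 'e) vfield \<Rightarrow> ('m \<Rightarrow> real) \<Rightarrow> 'm \<Rightarrow> real" where
  "dir_deriv \<A> V f p = (let c = (SOME c. c \<in> \<A> \<and> p \<in> fst c)
     in frechet_derivative (\<lambda>x. f (chart_inv c x)) (at (snd c p)) (V p c))"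

lemma smooth_on_differentiable:
  assumes "smooth_on S f" "x \<in> S"
  shows "f differentiable (at x)"
proof -
  have "ck_on (Suc 0) S f"
    using assms(1) unfolding smooth_on_def by blast
  then show ?thesis using assms(2) by simp
qed

lemma smooth_fun_imp_diff_fun: "smooth_fun \<A> f \<Longrightarrow> diff_fun \<A> f"
  unfolding smooth_fun_def diff_fun_def
  by (auto dest!: bspec intro!: smooth_on_differentiable simp: o_def)

lemma vector_field_imp_diff_field: "vector_field \<A> V \<Longrightarrow> diff_field \<A> V"
  unfolding vector_field_def diff_field_def
  by (auto intro!: smooth_on_differentiable)

section \<open>Charts, tangent spaces and directional derivatives\<close>

lemma smooth_atlas_inj: "smooth_atlas \<A> \<Longrightarrow> c \<in> \<A> \<Longrightarrow> inj_on (snd c) (fst c)"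
  unfolding smooth_atlas_def homeomorphism_def by (metis inj_onI)

lemma chart_inv_chart [simp]:
  "smooth_atlas \<A> \<Longrightarrow> c \<in> \<A> \<Longrightarrow> p \<in> fst c \<Longrightarrow> chart_inv c (snd c p) = p"
  unfolding chart_inv_def by (simp add: smooth_atlas_inj inv_into_f_f)

lemma smooth_atlas_chart_at: "smooth_atlas \<A> \<Longrightarrow> \<exists>c. c \<in> \<A> \<and> p \<in> fst c"
  unfolding smooth_atlas_def by blast

text \<open>A chart is a homeomorphism onto an open set, so it carries the open overlap to an open
  set. Openness matters because two coordinate expressions agree only on the overlap, and
  derivatives at a point need agreement near it.\<close>

lemma open_chart_overlap:
  assumes "smooth_atlas \<A>" "c \<in> \<A>" "d \<in> \<A>"
  shows "open (snd c ` (fst c \<inter> fst d))"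
proof -
  have hom: "homeomorphism (fst c) (snd c ` fst c) (snd c) (chart_inv c)"
    and o: "open (fst d)" "open (snd c ` fst c)"
    using assms unfolding smooth_atlas_def by auto
  have "openin (top_of_set (fst c)) (fst c \<inter> fst d)"
    using o by (simp add: openin_open_Int)
  then have "openin (top_of_set (snd c ` fst c)) (snd c ` (fst c \<inter> fst d))"
    using hom homeomorphism_imp_open_map by blast
  then show ?thesis
    using o openin_open_eq by blast
qed

lemma transition_differentiable:
  assumes "smooth_atlas \<A>" "c \<in> \<A>" "d \<in> \<A>" "p \<in> fst c" "p \<in> fst d"
  shows "(snd d \<circ> chart_inv c) differentiable (at (snd c p))"
  using assms unfolding smooth_atlas_def by (intro smooth_on_differentiable) blast+

lemma tangent_spaceI:
  assumes "\<And>c. \<not> (c \<in> \<A> \<and> p \<in> fst c) \<Longrightarrow> v c = 0"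
    and "\<And>c d. c \<in> \<A> \<Longrightarrow> d \<in> \<A> \<Longrightarrow> p \<in> fst c \<Longrightarrow> p \<in> fst d \<Longrightarrow>
      v d = frechet_derivative (snd d \<circ> chart_inv c) (at (snd c p)) (v c)"
  shows "v \<in> tangent_space \<A> p"
  using assms unfolding tangent_space_def by blast

lemma tangent_space_outside: "v \<in> tangent_space \<A> p \<Longrightarrow> \<not> (c \<in> \<A> \<and> p \<in> fst c) \<Longrightarrow> v c = 0"
  unfolding tangent_space_def by blast

lemma tangent_space_transform:
  assumes "v \<in> tangent_space \<A> p" "c \<in> \<A>" "d \<in> \<A>" "p \<in> fst c" "p \<in> fst d"
  shows "frechet_derivative (snd d \<circ> chart_inv c) (at (snd c p)) (v c) = v d"
proof -
  have "v d = frechet_derivative (snd d \<circ> chart_inv c) (at (snd c p)) (v c)"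
    using assms unfolding tangent_space_def by blast
  then show ?thesis by (rule sym)
qed

lemma tangent_space_subspace:
  assumes "smooth_atlas \<A>"
  shows "subspace (tangent_space \<A> p)"
proof (rule subspaceI)
  have lin: "linear (frechet_derivative (snd d \<circ> chart_inv c) (at (snd c p)))"
    if "c \<in> \<A>" "d \<in> \<A>" "p \<in> fst c" "p \<in> fst d" for c d
    using transition_differentiable[OF assms that] by (rule linear_frechet_derivative)
  show "0 \<in> tangent_space \<A> p"
    by (rule tangent_spaceI) (simp_all add: linear_0[OF lin] fun_apply_simps)
  show "u + v \<in> tangent_space \<A> p" if "u \<in> tangent_space \<A> p" "v \<in> tangent_space \<A> p" for u v
    using that
    by (intro tangent_spaceI) (simp_all add: linear_add[OF lin] fun_apply_simps tangent_space_outside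
        tangent_space_transform)
  show "a *\<^sub>R u \<in> tangent_space \<A> p" if "u \<in> tangent_space \<A> p" for a u
    using that
    by (intro tangent_spaceI) (simp_all add: linear_scale[OF lin] tangent_space_outside
        tangent_space_transform scaleR_fun_def)
qed

text \<open>A single component determines a tangent vector: the transformation law fixes the
  components in the other charts around the point, and all remaining ones are zero by convention.
  Questions about \<open>tangent_space\<close> thus become questions about the Euclidean model
  space.\<close>

lemma tangent_eqI:
  assumes "smooth_atlas \<A>" "u \<in> tangent_space \<A> p" "v \<in> tangent_space \<A> p"
    and "c \<in> \<A>" "p \<in> fst c" "u c = v c"
  shows "u = v"
proof
  fix d
  show "u d = v d"
    using assms tangent_space_outside[of _ \<A> p d] tangent_space_transform[of _ \<A> p c d]
    by (cases "d \<in> \<A> \<and> p \<in> fst d") metis+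
qed

text \<open>In any other chart the function is its expression in the chosen chart composed with a
  transition map. By the chain rule its derivative picks up the derivative of that map, which is
  exactly what the transformation law applies to \<open>V p c\<close>.\<close>

lemma dir_deriv_chart:
  assumes at: "smooth_atlas \<A>" and V: "V p \<in> tangent_space \<A> p" and f: "diff_fun \<A> f"
    and c: "c \<in> \<A>" "p \<in> fst c"
  shows "dir_deriv \<A> V f p = frechet_derivative (\<lambda>x. f (chart_inv c x)) (at (snd c p)) (V p c)"
proof -
  define d where "d = (SOME c. c \<in> \<A> \<and> p \<in> fst c)"
  have d: "d \<in> \<A>" "p \<in> fst d"
    using someI_ex[OF smooth_atlas_chart_at[OF at, of p]] by (auto simp: d_def)
  let ?t = "snd d \<circ> chart_inv c" and ?fd = "\<lambda>x. f (chart_inv d x)"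
  have "(?t has_derivative frechet_derivative ?t (at (snd c p))) (at (snd c p))"
    using transition_differentiable[OF at c(1) d(1) c(2) d(2)] by (simp add: frechet_derivative_works)
  moreover have "(?fd has_derivative frechet_derivative ?fd (at (snd d p))) (at (?t (snd c p)))"
    using f d at c unfolding diff_fun_def by (simp add: frechet_derivative_works)
  ultimately have "(?fd \<circ> ?t has_derivative
      frechet_derivative ?fd (at (snd d p)) \<circ> frechet_derivative ?t (at (snd c p))) (at (snd c p))"
    by (rule diff_chain_at)
  moreover have "(?fd \<circ> ?t) x = f (chart_inv c x)" if "x \<in> snd c ` (fst c \<inter> fst d)" for x
    using that at c d by auto
  ultimately have "((\<lambda>x. f (chart_inv c x)) has_derivative
      frechet_derivative ?fd (at (snd d p)) \<circ> frechet_derivative ?t (at (snd c p))) (at (snd c p))"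
    using open_chart_overlap[OF at c(1) d(1)] c d
    by (elim has_derivative_transform_within_open) auto
  then have "frechet_derivative (\<lambda>x. f (chart_inv c x)) (at (snd c p)) (V p c)
      = frechet_derivative ?fd (at (snd d p)) (frechet_derivative ?t (at (snd c p)) (V p c))"
    by (metis comp_apply frechet_derivative_at)
  also have "frechet_derivative ?t (at (snd c p)) (V p c) = V p d"
    using V c d by (simp add: tangent_space_transform)
  finally show ?thesis by (simp add: dir_deriv_def Let_def d_def)
qed

section \<open>Differentiable vector fields and the Leibniz rule for the bracket\<close>

lemma diff_field_tangent: "diff_field \<A> V \<Longrightarrow> V p \<in> tangent_space \<A> p"
  by (simp add: diff_field_def)

lemma diff_field_has_derivative:
  assumes "diff_field \<A> V" "c \<in> \<A>" "p \<in> fst c"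
  shows "((\<lambda>x. V (chart_inv c x) c) has_derivative
    frechet_derivative (\<lambda>x. V (chart_inv c x) c) (at (snd c p))) (at (snd c p))"
  using assms by (simp add: diff_field_def frechet_derivative_works)

lemma diff_field_add:
  assumes "smooth_atlas \<A>" "diff_field \<A> V" "diff_field \<A> W"
  shows "diff_field \<A> (V + W)"
  using assms unfolding diff_field_def
  by (auto intro!: subspace_add[OF tangent_space_subspace] differentiable_add simp: fun_apply_simps)

lemma diff_field_zero: "smooth_atlas \<A> \<Longrightarrow> diff_field \<A> 0"
  unfolding diff_field_def
  by (auto intro!: subspace_0[OF tangent_space_subspace] simp: fun_apply_simps)

lemma diff_field_fscale:
  assumes "smooth_atlas \<A>" "diff_fun \<A> f" "diff_field \<A> V"
  shows "diff_field \<A> (fscale f V)"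
  using assms unfolding diff_field_def diff_fun_def fscale_def
  by (simp add: scaleR_fun_def subspace_scale[OF tangent_space_subspace, unfolded scaleR_fun_def])

lemma lie_bracket_antisym: "lie_bracket \<A> V W = - lie_bracket \<A> W V"
  by (simp add: lie_bracket_def fun_eq_iff fun_apply_simps)

lemma lie_bracket_add_left:
  assumes "diff_field \<A> V" "diff_field \<A> V'" "diff_field \<A> W"
  shows "lie_bracket \<A> (V + V') W = lie_bracket \<A> V W + lie_bracket \<A> V' W"
proof (intro ext)
  fix p c
  show "lie_bracket \<A> (V + V') W p c = (lie_bracket \<A> V W + lie_bracket \<A> V' W) p c"
  proof (cases "c \<in> \<A> \<and> p \<in> fst c")
    case True
    then have c: "c \<in> \<A>" "p \<in> fst c" by auto
    have "frechet_derivative (\<lambda>x. V (chart_inv c x) c + V' (chart_inv c x) c) (at (snd c p))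
        = (\<lambda>h. frechet_derivative (\<lambda>x. V (chart_inv c x) c) (at (snd c p)) h
             + frechet_derivative (\<lambda>x. V' (chart_inv c x) c) (at (snd c p)) h)"
      using diff_field_has_derivative[OF assms(1) c] diff_field_has_derivative[OF assms(2) c]
      by (intro frechet_derivative_at[symmetric] has_derivative_add)
    moreover have "linear (frechet_derivative (\<lambda>x. W (chart_inv c x) c) (at (snd c p)))"
      using diff_field_has_derivative[OF assms(3) c] by (rule has_derivative_linear)
    ultimately show ?thesis
      using c by (simp add: lie_bracket_def linear_add fun_apply_simps)
  qed (auto simp: lie_bracket_def fun_apply_simps)
qed

text \<open>This is the product rule in a chart. The term \<open>(W f) V\<close> has a minus sign
  because the second half of the bracket differentiates the first field along
  \<open>W\<close>.\<close>

lemma lie_bracket_fscale_left: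
  assumes at: "smooth_atlas \<A>" and f: "diff_fun \<A> f" and V: "diff_field \<A> V"
    and W: "diff_field \<A> W"
  shows "lie_bracket \<A> (fscale f V) W = fscale f (lie_bracket \<A> V W) - fscale (dir_deriv \<A> W f) V"
proof (intro ext)
  fix p c
  show "lie_bracket \<A> (fscale f V) W p c
      = (fscale f (lie_bracket \<A> V W) - fscale (dir_deriv \<A> W f) V) p c"
  proof (cases "c \<in> \<A> \<and> p \<in> fst c")
    case True
    then have c: "c \<in> \<A>" "p \<in> fst c" by auto
    have "((\<lambda>x. f (chart_inv c x)) has_derivative
        frechet_derivative (\<lambda>x. f (chart_inv c x)) (at (snd c p))) (at (snd c p))"
      using f c by (simp add: diff_fun_def frechet_derivative_works)
    from has_derivative_scaleR[OF this diff_field_has_derivative[OF V c]]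
    have "frechet_derivative (\<lambda>x. f (chart_inv c x) *\<^sub>R V (chart_inv c x) c) (at (snd c p))
        = (\<lambda>h. f p *\<^sub>R frechet_derivative (\<lambda>x. V (chart_inv c x) c) (at (snd c p)) h
             + frechet_derivative (\<lambda>x. f (chart_inv c x)) (at (snd c p)) h *\<^sub>R V p c)"
      using at c by (simp add: frechet_derivative_at[symmetric])
    moreover have "linear (frechet_derivative (\<lambda>x. W (chart_inv c x) c) (at (snd c p)))"
      using diff_field_has_derivative[OF W c] by (rule has_derivative_linear)
    ultimately show ?thesis
      using c dir_deriv_chart[where V = W, OF at diff_field_tangent[OF W] f c]
      by (simp add: lie_bracket_def fscale_def scaleR_fun_def fun_apply_simps linear_scale algebra_simps)
  \<comment> \<open>Outside the chart the bracket is zero by definition, and the correction term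
    vanishes too because \<open>V p c\<close> is zero for a tangent vector.\<close>
  next
    case False
    then show ?thesis
      using tangent_space_outside[OF diff_field_tangent[OF V] False]
      by (auto simp: lie_bracket_def fscale_def scaleR_fun_def fun_apply_simps)
  qed
qed

lemma diff_fun_const: "diff_fun \<A> (\<lambda>_. a)"
  by (simp add: diff_fun_def)

lemma fscale_const: "fscale (\<lambda>_. a) V = a *\<^sub>R V"
  by (simp add: fscale_def scaleR_fun_def)

text \<open>A real factor is a constant function, whose derivative kills the correction term of the
  Leibniz rule.\<close>

lemma lie_bracket_scaleR_left:
  assumes "smooth_atlas \<A>" "diff_field \<A> V" "diff_field \<A> W"
  shows "lie_bracket \<A> (a *\<^sub>R V) W = a *\<^sub>R lie_bracket \<A> V W"
proof -
  have "fscale (dir_deriv \<A> W (\<lambda>_. a)) V = 0"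
    by (simp add: fscale_def dir_deriv_def zero_fun_def)
  then show ?thesis
    using lie_bracket_fscale_left[OF assms(1) diff_fun_const assms(2,3), of a]
    by (simp add: fscale_const)
qed

lemma lie_bracket_minus_left:
  assumes "smooth_atlas \<A>" "diff_field \<A> V" "diff_field \<A> W"
  shows "lie_bracket \<A> (- V) W = - lie_bracket \<A> V W"
  using lie_bracket_scaleR_left[OF assms, of "-1"] by simp

section \<open>Tensoriality of the Nijenhuis tensor\<close>

text \<open>The module generated by \<open>B\<close> over the differentiable functions. Its
  inductive form makes each tensoriality argument an induction with one case per module
  operation.\<close>

inductive_set fun_span ::
    "('m, 'e::euclidean_space) chart set \<Rightarrow> ('m, 'e) vfield set \<Rightarrow> ('m, 'e) vfield set"
  for \<A> B where
    base: "V \<in> B \<Longrightarrow> V \<in> fun_span \<A> B"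
  | zero: "0 \<in> fun_span \<A> B"
  | add: "V \<in> fun_span \<A> B \<Longrightarrow> W \<in> fun_span \<A> B \<Longrightarrow> V + W \<in> fun_span \<A> B"
  | scale: "diff_fun \<A> f \<Longrightarrow> V \<in> fun_span \<A> B \<Longrightarrow> fscale f V \<in> fun_span \<A> B"

lemma fun_span_sum:
  assumes "\<And>i. i \<in> I \<Longrightarrow> V i \<in> fun_span \<A> B"
  shows "sum V I \<in> fun_span \<A> B"
  using assms by (induction I rule: infinite_finite_induct) (auto intro: fun_span.intros)

lemma span_subset_fun_span: "span B \<subseteq> fun_span \<A> B"
proof
  fix V assume "V \<in> span B"
  then show "V \<in> fun_span \<A> B"
    by (induction rule: span_induct_alt)
      (auto intro: fun_span.intros diff_fun_const simp flip: fscale_const)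
qed

text \<open>
  Assuming \<open>bracket_tangent\<close> avoids the transformation law of the bracket in general, which would
  need the symmetry of second derivatives.
\<close>

locale tangent_frame =
  fixes \<A> :: "('m::topological_space, 'e::euclidean_space) chart set"
    and J :: "'m \<Rightarrow> ('m, 'e) tangent \<Rightarrow> ('m, 'e) tangent"
    and B :: "('m, 'e) vfield set"
  assumes atlas: "smooth_atlas \<A>"
    and J: "almost_complex \<A> J"
    and base_diff: "V \<in> B \<Longrightarrow> diff_field \<A> V"
    and J_base: "V \<in> B \<Longrightarrow> apply_field J V \<in> fun_span \<A> B"
    and bracket_tangent: "V \<in> B \<Longrightarrow> W \<in> B \<Longrightarrow> lie_bracket \<A> V W p \<in> tangent_space \<A> p"
begin

lemma J_simps:
  assumes "u \<in> tangent_space \<A> p"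
  shows "J p u \<in> tangent_space \<A> p" "J p (a *\<^sub>R u) = a *\<^sub>R J p u" "J p (J p u) = - u"
    "J p (- u) = - J p u"
    "v \<in> tangent_space \<A> p \<Longrightarrow> J p (u + v) = J p u + J p v"
    "v \<in> tangent_space \<A> p \<Longrightarrow> J p (u - v) = J p u - J p v"
proof -
  have *: "J p u \<in> tangent_space \<A> p \<and> J p (u + v) = J p u + J p v \<and>
        J p (a *\<^sub>R u) = a *\<^sub>R J p u \<and> J p (J p u) = - u"
    if "u \<in> tangent_space \<A> p" "v \<in> tangent_space \<A> p" for u v a
    using J that unfolding almost_complex_def by blast
  show "J p u \<in> tangent_space \<A> p" "J p (a *\<^sub>R u) = a *\<^sub>R J p u" "J p (J p u) = - u"
    "v \<in> tangent_space \<A> p \<Longrightarrow> J p (u + v) = J p u + J p v" for a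
    using *[OF assms] assms by blast+
  have neg: "J p (- u) = - J p u" if "u \<in> tangent_space \<A> p" for u
    using *[OF that that, of "-1"] by (metis scaleR_minus1_left)
  show "J p (- u) = - J p u" by (rule neg[OF assms])
  show "J p (u - v) = J p u - J p v" if v: "v \<in> tangent_space \<A> p"
    using *[OF assms, of "- v"] neg[OF v] subspace_neg[OF tangent_space_subspace[OF atlas] v] by simp
qed

lemma fun_span_diff_field: "V \<in> fun_span \<A> B \<Longrightarrow> diff_field \<A> V"
  by (induction rule: fun_span.induct)
    (simp_all only: base_diff diff_field_add diff_field_fscale diff_field_zero atlas)

lemma fun_span_tangent: "V \<in> fun_span \<A> B \<Longrightarrow> V p \<in> tangent_space \<A> p"
  by (rule diff_field_tangent) (rule fun_span_diff_field)

lemma apply_field_add: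
  "V \<in> fun_span \<A> B \<Longrightarrow> W \<in> fun_span \<A> B \<Longrightarrow>
    apply_field J (V + W) = apply_field J V + apply_field J W"
  by (rule ext) (simp add: apply_field_def vfield_apply J_simps fun_span_tangent)

lemma apply_field_fscale:
  "V \<in> fun_span \<A> B \<Longrightarrow> apply_field J (fscale f V) = fscale f (apply_field J V)"
  by (rule ext) (simp add: apply_field_def fscale_def J_simps fun_span_tangent)

lemma apply_field_fun_span: "V \<in> fun_span \<A> B \<Longrightarrow> apply_field J V \<in> fun_span \<A> B"
proof (induction rule: fun_span.induct)
  case zero
  have "apply_field J 0 = 0"
    using apply_field_fscale[OF fun_span.zero, of "\<lambda>_. 0"] by (simp add: fscale_const)
  then show ?case by (simp add: fun_span.zero)
qed (auto simp: J_base apply_field_add apply_field_fscale intro: fun_span.intros)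

lemma apply_field_apply_field: "V \<in> fun_span \<A> B \<Longrightarrow> apply_field J (apply_field J V) = - V"
  by (rule ext) (simp add: apply_field_def vfield_apply J_simps fun_span_tangent)

text \<open>By the Leibniz rule, sums and function multiples in the first argument only produce sums
  and multiples of tangent vectors, so induction reduces that argument to the frame. Antisymmetry
  then gives the same for the second argument.\<close>

lemma fun_span_bracket_tangent:
  assumes "V \<in> fun_span \<A> B" "W \<in> fun_span \<A> B"
  shows "lie_bracket \<A> V W p \<in> tangent_space \<A> p"
proof -
  note sub = tangent_space_subspace[OF atlas]
  have step: "lie_bracket \<A> V W p \<in> tangent_space \<A> p"
    if W: "W \<in> fun_span \<A> B" and base: "\<And>V. V \<in> B \<Longrightarrow> lie_bracket \<A> V W p \<in> tangent_space \<A> p"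
      and V: "V \<in> fun_span \<A> B" for V W
    using V
  proof (induction rule: fun_span.induct)
    case zero
    show ?case
      using lie_bracket_scaleR_left[OF atlas diff_field_zero[OF atlas] fun_span_diff_field[OF W], of 0]
      by (metis scaleR_zero_left subspace_0[OF sub] vfield_apply(4))
  next
    case (add V V')
    then show ?case
      using W by (simp add: lie_bracket_add_left fun_span_diff_field)
        (simp add: vfield_apply subspace_add[OF sub])
  next
    case (scale f V)
    then show ?case
      using W by (simp add: lie_bracket_fscale_left[OF atlas] fun_span_diff_field)
        (simp add: fscale_def vfield_apply fun_span_tangent subspace_diff[OF sub] subspace_scale[OF sub])
  qed (rule base)
  have "lie_bracket \<A> W' V p \<in> tangent_space \<A> p" if W': "W' \<in> B" for W'
  proof -
    have "lie_bracket \<A> V W' p \<in> tangent_space \<A> p"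
      using step[OF fun_span.base[OF W'] bracket_tangent[OF _ W'] assms(1)] .
    then show ?thesis
      using subspace_neg[OF sub] lie_bracket_antisym[of \<A> W' V] by (simp add: vfield_apply)
  qed
  from step[OF assms(1) this assms(2)] show ?thesis
    using subspace_neg[OF sub] lie_bracket_antisym[of \<A> V W] by (simp add: vfield_apply)
qed

section \<open>Skewness, function-linearity and J-antilinearity of the Nijenhuis tensor\<close>

lemma nijenhuis_apply:
  "nijenhuis \<A> J V W p = lie_bracket \<A> V W p + J p (lie_bracket \<A> (apply_field J V) W p)
     + J p (lie_bracket \<A> V (apply_field J W) p) - lie_bracket \<A> (apply_field J V) (apply_field J W) p"
  by (simp add: nijenhuis_def apply_field_def vfield_apply)

lemma nijenhuis_antisym:
  assumes "V \<in> fun_span \<A> B" "W \<in> fun_span \<A> B"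
  shows "nijenhuis \<A> J V W = - nijenhuis \<A> J W V"
proof
  fix p
  show "nijenhuis \<A> J V W p = (- nijenhuis \<A> J W V) p"
    unfolding vfield_apply nijenhuis_apply
      lie_bracket_antisym[of \<A> V W] lie_bracket_antisym[of \<A> "apply_field J V"]
      lie_bracket_antisym[of \<A> V "apply_field J W"]
    using assms by (simp add: J_simps fun_span_bracket_tangent apply_field_fun_span)
qed

lemma nijenhuis_add_left:
  assumes "V \<in> fun_span \<A> B" "V' \<in> fun_span \<A> B" "W \<in> fun_span \<A> B"
  shows "nijenhuis \<A> J (V + V') W = nijenhuis \<A> J V W + nijenhuis \<A> J V' W"
  using assms
  by (intro ext[of "nijenhuis \<A> J (V + V') W"])
    (simp add: nijenhuis_apply apply_field_add lie_bracket_add_left fun_span_diff_field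
        apply_field_fun_span,
      simp add: vfield_apply nijenhuis_apply apply_field_fun_span J_simps fun_span_bracket_tangent)

text \<open>The four brackets contribute the corrections \<open>-(W f) V\<close>,
  \<open>-(W f) J(JV) = (W f) V\<close>, \<open>-(JW f) JV\<close> and \<open>(JW f) JV\<close>.
  They cancel in pairs, because J squares to minus the identity.\<close>

lemma nijenhuis_fscale_left:
  assumes f: "diff_fun \<A> f" and V: "V \<in> fun_span \<A> B" and W: "W \<in> fun_span \<A> B"
  shows "nijenhuis \<A> J (fscale f V) W = fscale f (nijenhuis \<A> J V W)"
proof
  fix p
  let ?S = "tangent_space \<A> p" and ?JV = "apply_field J V" and ?JW = "apply_field J W"
  note JV = apply_field_fun_span[OF V] and JW = apply_field_fun_span[OF W]
  have leib: "lie_bracket \<A> (fscale f U) U' p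
      = f p *\<^sub>R lie_bracket \<A> U U' p - dir_deriv \<A> U' f p *\<^sub>R U p"
    if "U \<in> fun_span \<A> B" "U' \<in> fun_span \<A> B" for U U'
    using that by (simp add: lie_bracket_fscale_left[OF atlas f] fun_span_diff_field)
      (simp add: fscale_def vfield_apply)
  have Jdiff: "J p (a *\<^sub>R u - b *\<^sub>R v) = a *\<^sub>R J p u - b *\<^sub>R J p v"
    if "u \<in> ?S" "v \<in> ?S" for u v a b
    using that by (simp add: J_simps subspace_scale[OF tangent_space_subspace[OF atlas]])
  have JJ: "J p (V p) = ?JV p" "J p (?JV p) = - V p"
    using V by (simp_all add: apply_field_def J_simps fun_span_tangent)
  show "nijenhuis \<A> J (fscale f V) W p = fscale f (nijenhuis \<A> J V W) p"
    unfolding nijenhuis_apply apply_field_fscale[OF V] fscale_def[of f "nijenhuis \<A> J V W"]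
    by (simp add: leib V W JV JW Jdiff fun_span_bracket_tangent fun_span_tangent JJ algebra_simps)
qed

text \<open>With \<open>J(JV) = -V\<close> both sides become
  \<open>[JV,W] - J[V,W] + J[JV,JW] + [V,JW]\<close>. This later transfers vanishing from
  \<open>X\<close> to \<open>Y = JX\<close>.\<close>

lemma nijenhuis_J_left:
  assumes V: "V \<in> fun_span \<A> B" and W: "W \<in> fun_span \<A> B"
  shows "nijenhuis \<A> J (apply_field J V) W = - apply_field J (nijenhuis \<A> J V W)"
proof
  fix p
  note JV = apply_field_fun_span[OF V] and JW = apply_field_fun_span[OF W]
  have neg: "lie_bracket \<A> (- V) U = - lie_bracket \<A> V U" if "U \<in> fun_span \<A> B" for U
    using that V by (simp add: lie_bracket_minus_left fun_span_diff_field atlas)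
  show "nijenhuis \<A> J (apply_field J V) W p = (- apply_field J (nijenhuis \<A> J V W)) p"
    unfolding vfield_apply apply_field_def[of J "nijenhuis \<A> J V W"] nijenhuis_apply
      apply_field_apply_field[OF V] neg[OF W] neg[OF JW]
    using V W JV JW
    by (simp add: J_simps fun_span_bracket_tangent subspace_add subspace_diff
        tangent_space_subspace[OF atlas] algebra_simps)
qed

lemma nijenhuis_eq_0:
  assumes N: "\<And>V W. V \<in> B \<Longrightarrow> W \<in> B \<Longrightarrow> nijenhuis \<A> J V W = 0"
    and "V \<in> fun_span \<A> B" "W \<in> fun_span \<A> B"
  shows "nijenhuis \<A> J V W = 0"
proof -
  \<comment> \<open>Only the first argument is extended from the frame to the module here. Using the
    fact twice, with antisymmetry in between, treats both arguments.\<close>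
  have step: "nijenhuis \<A> J V W = 0"
    if W: "W \<in> fun_span \<A> B" and base: "\<And>V. V \<in> B \<Longrightarrow> nijenhuis \<A> J V W = 0"
      and V: "V \<in> fun_span \<A> B" for V W
    using V
  proof (induction rule: fun_span.induct)
    case zero
    show ?case
      using nijenhuis_fscale_left[OF diff_fun_const fun_span.zero W, of 0]
      by (simp add: fscale_const)
  next
    case (scale f V)
    then show ?case
      using W by (simp add: nijenhuis_fscale_left) (simp add: fscale_def vfield_apply fun_eq_iff)
  qed (simp_all add: base W nijenhuis_add_left)
  have "nijenhuis \<A> J U V = 0" if U: "U \<in> B" for U
    using step[OF fun_span.base[OF U] N[OF _ U] assms(2)]
      nijenhuis_antisym[OF fun_span.base[OF U] assms(2)] by simp
  from step[OF assms(2) this assms(3)] show ?thesis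
    using nijenhuis_antisym[OF assms(2,3)] by simp
qed

end

section \<open>Orthonormal frames\<close>

lemma sum_fun_apply: "(\<Sum>i\<in>I. f i) x = (\<Sum>i\<in>I. f i x)"
  by (induction I rule: infinite_finite_induct) (simp_all add: fun_apply_simps)

lemma riemannian_metric_sum_left:
  assumes at: "smooth_atlas \<A>" and g: "riemannian_metric \<A> g"
    and u: "\<And>i. i \<in> I \<Longrightarrow> u i \<in> tangent_space \<A> p" and w: "w \<in> tangent_space \<A> p"
  shows "g p (\<Sum>i\<in>I. a i *\<^sub>R u i) w = (\<Sum>i\<in>I. a i * g p (u i) w)"
proof -
  note sub = tangent_space_subspace[OF at, of p]
  have add: "g p (u + v) w = g p u w + g p v w" and scale: "g p (a *\<^sub>R u) w = a * g p u w"
    if "u \<in> tangent_space \<A> p" "v \<in> tangent_space \<A> p" for u v a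
    using g that w unfolding riemannian_metric_def by blast+
  have zero: "g p 0 w = 0"
    using scale[OF subspace_0[OF sub] subspace_0[OF sub], of 0] by simp
  show ?thesis
    using u
  proof (induction I rule: infinite_finite_induct)
    case (insert i I)
    have "(\<Sum>i\<in>I. a i *\<^sub>R u i) \<in> tangent_space \<A> p"
      using insert.prems by (intro subspace_sum[OF sub] subspace_scale[OF sub]) auto
    moreover have "u i \<in> tangent_space \<A> p" "a i *\<^sub>R u i \<in> tangent_space \<A> p"
      using insert.prems by (auto intro: subspace_scale[OF sub])
    ultimately show ?case
      using insert by (simp add: add scale)
  qed (simp_all add: zero)
qed

text \<open>Pairing with the metric shows the vectors to be independent. Their components in one
  chart are therefore \<open>DIM('e)\<close> independent vectors of the model space, hence a basis
  of it; \<open>tangent_eqI\<close> lifts the expansion back, and pairing again identifies the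
  coefficients.\<close>

lemma orthonormal_expansion:
  fixes \<A> :: "('m::topological_space, 'e::euclidean_space) chart set"
  assumes at: "smooth_atlas \<A>" and g: "riemannian_metric \<A> g"
    and e: "\<And>i. i < DIM('e) \<Longrightarrow> e i \<in> tangent_space \<A> p"
    and orth: "\<And>i j. \<lbrakk>i < DIM('e); j < DIM('e)\<rbrakk> \<Longrightarrow> g p (e i) (e j) = (if i = j then 1 else 0)"
    and u: "u \<in> tangent_space \<A> p"
  shows "u = (\<Sum>i<DIM('e). g p u (e i) *\<^sub>R e i)"
proof -
  let ?n = "DIM('e)"
  note sub = tangent_space_subspace[OF at, of p]
  have coeff: "g p (\<Sum>i<?n. a i *\<^sub>R e i) (e j) = a j" if "j < ?n" for a j
  proof -
    have "g p (\<Sum>i<?n. a i *\<^sub>R e i) (e j) = (\<Sum>i<?n. a i * g p (e i) (e j))"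
      by (rule riemannian_metric_sum_left[OF at g]) (use e that in auto)
    also have "\<dots> = (\<Sum>i<?n. if i = j then a i else 0)"
      using orth that by (intro sum.cong) auto
    finally show ?thesis using that by simp
  qed
  have sum_in: "(\<Sum>i<?n. a i *\<^sub>R e i) \<in> tangent_space \<A> p" for a
    using e by (intro subspace_sum[OF sub] subspace_scale[OF sub]) auto
  obtain c where c: "c \<in> \<A>" "p \<in> fst c"
    using smooth_atlas_chart_at[OF at] by blast
  have sum_c: "(\<Sum>i<?n. a i *\<^sub>R e i) c = (\<Sum>i<?n. a i *\<^sub>R e i c)" for a
    by (simp add: sum_fun_apply scaleR_fun_def)
  have indep: "a j = 0" if "(\<Sum>i<?n. a i *\<^sub>R e i c) = 0" "j < ?n" for a j
  proof -
    \<comment> \<open>Zero is written as a combination with zero coefficients, so that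
      \<open>coeff\<close> can be applied to both sides.\<close>
    have "(\<Sum>i<?n. a i *\<^sub>R e i) = (\<Sum>i<?n. 0 *\<^sub>R e i)"
      using that(1) by (intro tangent_eqI[OF at sum_in sum_in c]) (simp add: sum_c fun_apply_simps)
    then show ?thesis
      using coeff[OF that(2), of a] coeff[OF that(2), of "\<lambda>_. 0"] by simp
  qed
  have inj: "inj_on (\<lambda>i. e i c) {..<?n}"
  proof (rule inj_onI)
    fix i j assume ij: "i \<in> {..<?n}" "j \<in> {..<?n}" "e i c = e j c"
    then have "e i = e j"
      using e by (intro tangent_eqI[OF at _ _ c]) auto
    then show "i = j"
      using orth[of i j] orth[of j j] ij by (auto split: if_splits)
  qed
  let ?B = "(\<lambda>i. e i c) ` {..<?n}"
  have "independent ?B"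
  proof (rule independent_if_scalars_zero)
    fix f x assume "(\<Sum>x\<in>?B. f x *\<^sub>R x) = 0" "x \<in> ?B"
    then show "f x = 0"
      using indep[of "\<lambda>i. f (e i c)"] by (auto simp: sum.reindex[OF inj])
  qed simp
  moreover have "card ?B = ?n"
    using inj by (simp add: card_image)
  ultimately have "span ?B = UNIV"
    using card_ge_dim_independent[of ?B UNIV] by (auto simp: dim_UNIV)
  then have "u c \<in> span ?B" by simp
  then obtain f where "u c = (\<Sum>x\<in>?B. f x *\<^sub>R x)"
    by (auto simp: span_finite)
  then have "u c = (\<Sum>i<?n. f (e i c) *\<^sub>R e i c)"
    by (simp add: sum.reindex[OF inj])
  then have "u = (\<Sum>i<?n. f (e i c) *\<^sub>R e i)"
    by (intro tangent_eqI[OF at u sum_in c]) (simp add: sum_c)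
  then show ?thesis
    using coeff[where a = "\<lambda>i. f (e i c)"] by simp
qed

text \<open>The coefficients are \<open>g(V, e_i)\<close>. They are smooth because a Riemannian
  metric takes smooth fields to smooth functions, so the expansion at each point is one over
  differentiable functions.\<close>

lemma vector_field_in_fun_span:
  fixes \<A> :: "('m::topological_space, 'e::euclidean_space) chart set"
  assumes at: "smooth_atlas \<A>" and g: "riemannian_metric \<A> g"
    and len: "length es = DIM('e)" and es: "\<And>E. E \<in> set es \<Longrightarrow> vector_field \<A> E"
    and orth: "\<And>i j p. \<lbrakk>i < length es; j < length es\<rbrakk> \<Longrightarrow>
      g p ((es ! i) p) ((es ! j) p) = (if i = j then 1 else 0)"
    and V: "vector_field \<A> V"
  shows "V \<in> fun_span \<A> (set es)"
proof -
  have tangent: "W p \<in> tangent_space \<A> p" if "vector_field \<A> W" for W p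
    using that by (simp add: vector_field_def)
  have e: "vector_field \<A> (es ! i)" if "i < DIM('e)" for i
    using es len that by simp
  have "V p = (\<Sum>i<DIM('e). g p (V p) ((es ! i) p) *\<^sub>R (es ! i) p)" for p
    by (rule orthonormal_expansion[OF at g]) (use tangent e V orth len in auto)
  then have "V = (\<Sum>i<DIM('e). fscale (\<lambda>p. g p (V p) ((es ! i) p)) (es ! i))"
    by (intro ext[of V]) (simp add: sum_fun_apply fscale_def)
  moreover have "fscale (\<lambda>p. g p (V p) ((es ! i) p)) (es ! i) \<in> fun_span \<A> (set es)"
    if "i < DIM('e)" for i
  proof (rule fun_span.scale)
    show "diff_fun \<A> (\<lambda>p. g p (V p) ((es ! i) p))"
      using g V e[OF that] unfolding riemannian_metric_def by (blast intro: smooth_fun_imp_diff_fun)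
    show "es ! i \<in> fun_span \<A> (set es)"
      using that len by (simp add: fun_span.base)
  qed
  ultimately show ?thesis
    using fun_span_sum[of "{..<DIM('e)}"] by (metis (no_types, lifting) lessThan_iff)
qed

section \<open>The Nijenhuis tensor in terms of the bracket relations\<close>

lemma eq_uminus_imp_zero:
  fixes x :: "'a::real_vector"
  assumes "x = - x"
  shows "x = 0"
proof -
  have "(2::real) *\<^sub>R x = 0"
    using assms by (metis add.right_inverse scaleR_2)
  then show ?thesis by simp
qed

text \<open>The bracket relations are abstracted from the manifold, so that the rest is linear
  algebra. Linearity is assumed on the span of the basis only: \<open>lie_bracket\<close> is defined
  through \<open>frechet_derivative\<close> and is known to be linear on differentiable
  fields.\<close>

locale bracket_table =
  fixes br :: "'v::real_vector \<Rightarrow> 'v \<Rightarrow> 'v"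
    and A B C R S T X Y :: 'v
    and \<rho> b11 b21 c11 c12 c21 c22 s14 s24 t14 t15 t24 t25 :: real
    and \<theta>1 \<theta>2 \<theta>3 \<theta>4 \<theta>5 \<theta>6 :: real
  assumes skew: "br u v = - br v u"
    and br_add_left: "\<lbrakk>u \<in> span {A, B, C, R, S, T, X, Y}; v \<in> span {A, B, C, R, S, T, X, Y};
        w \<in> span {A, B, C, R, S, T, X, Y}\<rbrakk> \<Longrightarrow> br (u + v) w = br u w + br v w"
    and br_scale_left: "\<lbrakk>u \<in> span {A, B, C, R, S, T, X, Y}; w \<in> span {A, B, C, R, S, T, X, Y}\<rbrakk>
        \<Longrightarrow> br (a *\<^sub>R u) w = a *\<^sub>R br u w"
    and brackets_K: "br A B = 2 *\<^sub>R C" "br B C = 2 *\<^sub>R A" "br C A = 2 *\<^sub>R B"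
      "br R S = 2 *\<^sub>R T" "br S T = 2 *\<^sub>R R" "br T R = 2 *\<^sub>R S"
      "\<And>E F. E \<in> {A, B, C} \<Longrightarrow> F \<in> {R, S, T} \<Longrightarrow> br E F = 0"
    and brackets_XY:
      "br A X = - b11 *\<^sub>R B - c11 *\<^sub>R C" "br A Y = - b21 *\<^sub>R B - c21 *\<^sub>R C"
      "br B X = b11 *\<^sub>R A - c12 *\<^sub>R C" "br B Y = b21 *\<^sub>R A - c22 *\<^sub>R C"
      "br C X = c11 *\<^sub>R A + c12 *\<^sub>R B" "br C Y = c21 *\<^sub>R A + c22 *\<^sub>R B"
      "br R X = - s14 *\<^sub>R S - t14 *\<^sub>R T" "br R Y = - s24 *\<^sub>R S - t24 *\<^sub>R T"
      "br S X = s14 *\<^sub>R R - t15 *\<^sub>R T" "br S Y = s24 *\<^sub>R R - t25 *\<^sub>R T"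
      "br T X = t14 *\<^sub>R R + t15 *\<^sub>R S" "br T Y = t24 *\<^sub>R R + t25 *\<^sub>R S"
      "br X Y = \<rho> *\<^sub>R X + \<theta>1 *\<^sub>R A + \<theta>2 *\<^sub>R B + \<theta>3 *\<^sub>R C + \<theta>4 *\<^sub>R R + \<theta>5 *\<^sub>R S + \<theta>6 *\<^sub>R T"
begin

text \<open>Coordinates turn vector identities into polynomial ones, compared entry by entry with
  \<open>comb_cong\<close>. The converse, that a zero vector has zero coordinates, needs
  independence and is derived from orthonormality in the final proof.\<close>

definition comb :: "real \<Rightarrow> real \<Rightarrow> real \<Rightarrow> real \<Rightarrow> real \<Rightarrow> real \<Rightarrow> real \<Rightarrow> real \<Rightarrow> 'v" where
  "comb a b c r s t x y = a *\<^sub>R A + b *\<^sub>R B + c *\<^sub>R C + r *\<^sub>R R + s *\<^sub>R S + t *\<^sub>R T + x *\<^sub>R X + y *\<^sub>R Y"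

lemma base_comb:
  "A = comb 1 0 0 0 0 0 0 0" "B = comb 0 1 0 0 0 0 0 0" "C = comb 0 0 1 0 0 0 0 0"
  "R = comb 0 0 0 1 0 0 0 0" "S = comb 0 0 0 0 1 0 0 0" "T = comb 0 0 0 0 0 1 0 0"
  "X = comb 0 0 0 0 0 0 1 0" "Y = comb 0 0 0 0 0 0 0 1"
  by (simp_all add: comb_def)

lemma comb_zero: "comb 0 0 0 0 0 0 0 0 = 0"
  by (simp add: comb_def)

lemma comb_add:
  "comb a b c r s t x y + comb a' b' c' r' s' t' x' y'
    = comb (a + a') (b + b') (c + c') (r + r') (s + s') (t + t') (x + x') (y + y')"
  by (simp add: comb_def scaleR_add_left)

lemma comb_diff:
  "comb a b c r s t x y - comb a' b' c' r' s' t' x' y'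
    = comb (a - a') (b - b') (c - c') (r - r') (s - s') (t - t') (x - x') (y - y')"
  by (simp add: comb_def scaleR_diff_left)

lemma comb_scale:
  "k *\<^sub>R comb a b c r s t x y
    = comb (k * a) (k * b) (k * c) (k * r) (k * s) (k * t) (k * x) (k * y)"
  by (simp add: comb_def scaleR_add_right)

lemma comb_in_span: "comb a b c r s t x y \<in> span {A, B, C, R, S, T, X, Y}"
  unfolding comb_def by (intro span_add span_scale span_base) auto

lemma comb_cong:
  "\<lbrakk>a = a'; b = b'; c = c'; r = r'; s = s'; t = t'; x = x'; y = y'\<rbrakk>
    \<Longrightarrow> comb a b c r s t x y = comb a' b' c' r' s' t' x' y'"
  by simp

lemma br_self: "br u u = 0"
  using skew by (rule eq_uminus_imp_zero)

lemma br_comb_left: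
  assumes w: "w \<in> span {A, B, C, R, S, T, X, Y}"
  shows "br (comb a b c r s t x y) w
    = a *\<^sub>R br A w + b *\<^sub>R br B w + c *\<^sub>R br C w + r *\<^sub>R br R w + s *\<^sub>R br S w + t *\<^sub>R br T w
      + x *\<^sub>R br X w + y *\<^sub>R br Y w"
  unfolding comb_def by (simp add: br_add_left br_scale_left w span_add span_scale span_base)

lemma br_comb_right:
  assumes w: "w \<in> span {A, B, C, R, S, T, X, Y}"
  shows "br w (comb a b c r s t x y)
    = a *\<^sub>R br w A + b *\<^sub>R br w B + c *\<^sub>R br w C + r *\<^sub>R br w R + s *\<^sub>R br w S + t *\<^sub>R br w T
      + x *\<^sub>R br w X + y *\<^sub>R br w Y"
  unfolding skew[of w] br_comb_left[OF w] by simp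

lemma brackets_rev:
  "br B A = - 2 *\<^sub>R C" "br C B = - 2 *\<^sub>R A" "br A C = - 2 *\<^sub>R B"
  "br S R = - 2 *\<^sub>R T" "br T S = - 2 *\<^sub>R R" "br R T = - 2 *\<^sub>R S"
  "\<And>E F. E \<in> {A, B, C} \<Longrightarrow> F \<in> {R, S, T} \<Longrightarrow> br F E = 0"
  "br X A = b11 *\<^sub>R B + c11 *\<^sub>R C" "br Y A = b21 *\<^sub>R B + c21 *\<^sub>R C"
  "br X B = - b11 *\<^sub>R A + c12 *\<^sub>R C" "br Y B = - b21 *\<^sub>R A + c22 *\<^sub>R C"
  "br X C = - c11 *\<^sub>R A - c12 *\<^sub>R B" "br Y C = - c21 *\<^sub>R A - c22 *\<^sub>R B"
  "br X R = s14 *\<^sub>R S + t14 *\<^sub>R T" "br Y R = s24 *\<^sub>R S + t24 *\<^sub>R T"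
  "br X S = - s14 *\<^sub>R R + t15 *\<^sub>R T" "br Y S = - s24 *\<^sub>R R + t25 *\<^sub>R T"
  "br X T = - t14 *\<^sub>R R - t15 *\<^sub>R S" "br Y T = - t24 *\<^sub>R R - t25 *\<^sub>R S"
  "br Y X = - \<rho> *\<^sub>R X - \<theta>1 *\<^sub>R A - \<theta>2 *\<^sub>R B - \<theta>3 *\<^sub>R C - \<theta>4 *\<^sub>R R - \<theta>5 *\<^sub>R S - \<theta>6 *\<^sub>R T"
proof -
  show "br F E = 0" if "E \<in> {A, B, C}" "F \<in> {R, S, T}" for E F
    using brackets_K(7)[OF that] skew[of F E] by simp
qed (subst skew, simp add: brackets_K(1-6) brackets_XY)+

lemma br_base_comb:
  fixes v1 v2 v3 v4 v5 v6 v7 v8 :: real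
  defines "v \<equiv> comb v1 v2 v3 v4 v5 v6 v7 v8"
  shows
  "br A v = comb 0 (- 2 * v3 - b11 * v7 - b21 * v8) (2 * v2 - c11 * v7 - c21 * v8) 0 0 0 0 0"
  "br B v = comb (2 * v3 + b11 * v7 + b21 * v8) 0 (- 2 * v1 - c12 * v7 - c22 * v8) 0 0 0 0 0"
  "br C v = comb (- 2 * v2 + c11 * v7 + c21 * v8) (2 * v1 + c12 * v7 + c22 * v8) 0 0 0 0 0 0"
  "br R v = comb 0 0 0 0 (- 2 * v6 - s14 * v7 - s24 * v8) (2 * v5 - t14 * v7 - t24 * v8) 0 0"
  "br S v = comb 0 0 0 (2 * v6 + s14 * v7 + s24 * v8) 0 (- 2 * v4 - t15 * v7 - t25 * v8) 0 0"
  "br T v = comb 0 0 0 (- 2 * v5 + t14 * v7 + t24 * v8) (2 * v4 + t15 * v7 + t25 * v8) 0 0 0"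
  "br X v = comb (- b11 * v2 - c11 * v3 + \<theta>1 * v8) (b11 * v1 - c12 * v3 + \<theta>2 * v8)
     (c11 * v1 + c12 * v2 + \<theta>3 * v8) (- s14 * v5 - t14 * v6 + \<theta>4 * v8)
     (s14 * v4 - t15 * v6 + \<theta>5 * v8) (t14 * v4 + t15 * v5 + \<theta>6 * v8) (\<rho> * v8) 0"
  "br Y v = comb (- b21 * v2 - c21 * v3 - \<theta>1 * v7) (b21 * v1 - c22 * v3 - \<theta>2 * v7)
     (c21 * v1 + c22 * v2 - \<theta>3 * v7) (- s24 * v5 - t24 * v6 - \<theta>4 * v7)
     (s24 * v4 - t25 * v6 - \<theta>5 * v7) (t24 * v4 + t25 * v5 - \<theta>6 * v7) (- \<rho> * v7) 0"
  unfolding v_def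
  by (simp_all add: br_comb_right span_base br_self brackets_K brackets_XY brackets_rev)
    (simp_all add: comb_def algebra_simps)

text \<open>The last coordinate is zero because no bracket of two basis vectors has a
  \<open>Y\<close> component.\<close>

lemma br_comb:
  "br (comb u1 u2 u3 u4 u5 u6 u7 u8) (comb v1 v2 v3 v4 v5 v6 v7 v8) = comb
     (u2 * (2 * v3 + b11 * v7 + b21 * v8) + u3 * (- 2 * v2 + c11 * v7 + c21 * v8)
       + u7 * (- b11 * v2 - c11 * v3 + \<theta>1 * v8) + u8 * (- b21 * v2 - c21 * v3 - \<theta>1 * v7))
     (u1 * (- 2 * v3 - b11 * v7 - b21 * v8) + u3 * (2 * v1 + c12 * v7 + c22 * v8)
       + u7 * (b11 * v1 - c12 * v3 + \<theta>2 * v8) + u8 * (b21 * v1 - c22 * v3 - \<theta>2 * v7))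
     (u1 * (2 * v2 - c11 * v7 - c21 * v8) + u2 * (- 2 * v1 - c12 * v7 - c22 * v8)
       + u7 * (c11 * v1 + c12 * v2 + \<theta>3 * v8) + u8 * (c21 * v1 + c22 * v2 - \<theta>3 * v7))
     (u5 * (2 * v6 + s14 * v7 + s24 * v8) + u6 * (- 2 * v5 + t14 * v7 + t24 * v8)
       + u7 * (- s14 * v5 - t14 * v6 + \<theta>4 * v8) + u8 * (- s24 * v5 - t24 * v6 - \<theta>4 * v7))
     (u4 * (- 2 * v6 - s14 * v7 - s24 * v8) + u6 * (2 * v4 + t15 * v7 + t25 * v8)
       + u7 * (s14 * v4 - t15 * v6 + \<theta>5 * v8) + u8 * (s24 * v4 - t25 * v6 - \<theta>5 * v7))
     (u4 * (2 * v5 - t14 * v7 - t24 * v8) + u5 * (- 2 * v4 - t15 * v7 - t25 * v8)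
       + u7 * (t14 * v4 + t15 * v5 + \<theta>6 * v8) + u8 * (t24 * v4 + t25 * v5 - \<theta>6 * v7))
     (u7 * (\<rho> * v8) + u8 * (- \<rho> * v7)) 0"
  unfolding br_comb_left[OF comb_in_span] br_base_comb comb_scale comb_add
  by (rule comb_cong) simp_all

text \<open>This provides \<open>bracket_tangent\<close> for the frame: members of the span are
  differentiable fields, so their values are tangent vectors.\<close>

lemma br_in_span:
  assumes "E \<in> {A, B, C, R, S, T, X, Y}" "F \<in> {A, B, C, R, S, T, X, Y}"
  shows "br E F \<in> span {A, B, C, R, S, T, X, Y}"
proof -
  have "\<exists>u1 u2 u3 u4 u5 u6 u7 u8. V = comb u1 u2 u3 u4 u5 u6 u7 u8"
    if "V \<in> {A, B, C, R, S, T, X, Y}" for V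
    using that base_comb by blast
  from this[OF assms(1)] this[OF assms(2)] show ?thesis
    using br_comb comb_in_span by metis
qed

end

section \<open>The almost complex structure in coordinates\<close>

locale complex_bracket_table =
  bracket_table br A B C R S T X Y \<rho> b11 b21 c11 c12 c21 c22 s14 s24 t14 t15 t24 t25
    \<theta>1 \<theta>2 \<theta>3 \<theta>4 \<theta>5 \<theta>6
  for br :: "'v::real_vector \<Rightarrow> 'v \<Rightarrow> 'v" and A B C R S T X Y
    and \<rho> b11 b21 c11 c12 c21 c22 s14 s24 t14 t15 t24 t25 \<theta>1 \<theta>2 \<theta>3 \<theta>4 \<theta>5 \<theta>6 +
  fixes Jv :: "'v \<Rightarrow> 'v"
    and lam1 mu1 nu1 lam2 mu2 nu2 :: real
  assumes J_add: "\<lbrakk>u \<in> span {A, B, C, R, S, T, X, Y}; v \<in> span {A, B, C, R, S, T, X, Y}\<rbrakk>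
      \<Longrightarrow> Jv (u + v) = Jv u + Jv v"
    and J_scale: "u \<in> span {A, B, C, R, S, T, X, Y} \<Longrightarrow> Jv (a *\<^sub>R u) = a *\<^sub>R Jv u"
    and J_base:
      "Jv A = comb 0 (- nu1) (- mu1) (- lam1 * lam2) (lam1 * mu2) (- lam1 * nu2) 0 0"
      "Jv B = comb nu1 0 (- lam1) (mu1 * lam2) (- mu1 * mu2) (mu1 * nu2) 0 0"
      "Jv C = comb mu1 lam1 0 (- nu1 * lam2) (nu1 * mu2) (- nu1 * nu2) 0 0"
      "Jv R = comb (lam1 * lam2) (- mu1 * lam2) (nu1 * lam2) 0 (- nu2) (- mu2) 0 0"
      "Jv S = comb (- lam1 * mu2) (mu1 * mu2) (- nu1 * mu2) nu2 0 (- lam2) 0 0"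
      "Jv T = comb (lam1 * nu2) (- mu1 * nu2) (nu1 * nu2) mu2 lam2 0 0 0"
      "Jv X = Y" "Jv Y = - X"
    and units: "lam1\<^sup>2 + mu1\<^sup>2 + nu1\<^sup>2 = 1" "lam2\<^sup>2 + mu2\<^sup>2 + nu2\<^sup>2 = 1"
begin

lemma J_comb:
  "Jv (comb u1 u2 u3 u4 u5 u6 u7 u8) = comb
     (nu1 * u2 + mu1 * u3 + lam1 * lam2 * u4 - lam1 * mu2 * u5 + lam1 * nu2 * u6)
     (- nu1 * u1 + lam1 * u3 - mu1 * lam2 * u4 + mu1 * mu2 * u5 - mu1 * nu2 * u6)
     (- mu1 * u1 - lam1 * u2 + nu1 * lam2 * u4 - nu1 * mu2 * u5 + nu1 * nu2 * u6)
     (- lam1 * lam2 * u1 + mu1 * lam2 * u2 - nu1 * lam2 * u3 + nu2 * u5 + mu2 * u6)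
     (lam1 * mu2 * u1 - mu1 * mu2 * u2 + nu1 * mu2 * u3 - nu2 * u4 + lam2 * u6)
     (- lam1 * nu2 * u1 + mu1 * nu2 * u2 - nu1 * nu2 * u3 - mu2 * u4 - lam2 * u5)
     (- u8) u7"
proof -
  have JXY: "Jv X = comb 0 0 0 0 0 0 0 1" "Jv Y = comb 0 0 0 0 0 0 (-1) 0"
    by (simp_all add: J_base comb_def)
  have "Jv (comb u1 u2 u3 u4 u5 u6 u7 u8) = u1 *\<^sub>R Jv A + u2 *\<^sub>R Jv B + u3 *\<^sub>R Jv C + u4 *\<^sub>R Jv R
      + u5 *\<^sub>R Jv S + u6 *\<^sub>R Jv T + u7 *\<^sub>R Jv X + u8 *\<^sub>R Jv Y"
    unfolding comb_def by (simp add: J_add J_scale span_add span_scale span_base)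
  then show ?thesis
    unfolding J_base(1-6) JXY comb_scale comb_add
    by simp (rule comb_cong; simp add: algebra_simps)
qed

section \<open>The Nijenhuis tensor in coordinates\<close>

definition nij :: "'v \<Rightarrow> 'v \<Rightarrow> 'v" where
  "nij u v = br u v + Jv (br (Jv u) v) + Jv (br u (Jv v)) - br (Jv u) (Jv v)"

text \<open>These rules reduce polynomials modulo the two unit relations by eliminating the squares
  of \<open>lam1\<close> and \<open>lam2\<close>. The variants with a trailing factor
  \<open>z\<close> catch squares inside right-associated products.\<close>

lemma unit_rules:
  "lam1 * lam1 = 1 - mu1 * mu1 - nu1 * nu1" "lam1 * (lam1 * z) = (1 - mu1 * mu1 - nu1 * nu1) * z"
  "lam2 * lam2 = 1 - mu2 * mu2 - nu2 * nu2" "lam2 * (lam2 * z) = (1 - mu2 * mu2 - nu2 * nu2) * z"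
proof -
  show *: "lam1 * lam1 = 1 - mu1 * mu1 - nu1 * nu1" "lam2 * lam2 = 1 - mu2 * mu2 - nu2 * nu2"
    using units by (simp_all add: power2_eq_square)
  show "lam1 * (lam1 * z) = (1 - mu1 * mu1 - nu1 * nu1) * z"
    "lam2 * (lam2 * z) = (1 - mu2 * mu2 - nu2 * nu2) * z"
    by (simp_all flip: * mult.assoc)
qed

text \<open>
  Since \<open>comb\<close> carries the basis as hidden arguments, rewriting \<open>A\<close> into \<open>comb 1 0 0 0 0 0 0 0\<close> does
  not terminate; hence the basis vectors are spelled out as combinations and folded back.
\<close>

lemma nij_compact_comb:
  "nij (comb 1 0 0 0 0 0 0 0) (comb 0 1 0 0 0 0 0 0) = 0"
  "nij (comb 1 0 0 0 0 0 0 0) (comb 0 0 1 0 0 0 0 0) = 0"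
  "nij (comb 0 1 0 0 0 0 0 0) (comb 0 0 1 0 0 0 0 0) = 0"
  "nij (comb 0 0 0 1 0 0 0 0) (comb 0 0 0 0 1 0 0 0) = 0"
  "nij (comb 0 0 0 1 0 0 0 0) (comb 0 0 0 0 0 1 0 0) = 0"
  "nij (comb 0 0 0 0 1 0 0 0) (comb 0 0 0 0 0 1 0 0) = 0"
  "nij (comb 1 0 0 0 0 0 0 0) (comb 0 0 0 1 0 0 0 0) = 0"
  "nij (comb 1 0 0 0 0 0 0 0) (comb 0 0 0 0 1 0 0 0) = 0"
  "nij (comb 1 0 0 0 0 0 0 0) (comb 0 0 0 0 0 1 0 0) = 0"
  "nij (comb 0 1 0 0 0 0 0 0) (comb 0 0 0 1 0 0 0 0) = 0"
  "nij (comb 0 1 0 0 0 0 0 0) (comb 0 0 0 0 1 0 0 0) = 0"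
  "nij (comb 0 1 0 0 0 0 0 0) (comb 0 0 0 0 0 1 0 0) = 0"
  "nij (comb 0 0 1 0 0 0 0 0) (comb 0 0 0 1 0 0 0 0) = 0"
  "nij (comb 0 0 1 0 0 0 0 0) (comb 0 0 0 0 1 0 0 0) = 0"
  "nij (comb 0 0 1 0 0 0 0 0) (comb 0 0 0 0 0 1 0 0) = 0"
  unfolding nij_def comb_zero[symmetric]
  by (simp add: br_comb J_comb comb_add comb_diff; rule comb_cong; simp add: algebra_simps unit_rules)+

lemmas nij_compact = nij_compact_comb[folded base_comb]

definition "p1 = (1 - nu1\<^sup>2) * b11 - mu1 * nu1 * c11 - lam1 * nu1 * c12 + lam1 * c21 - mu1 * c22"
definition "p2 = (1 - mu1\<^sup>2) * c11 - mu1 * nu1 * b11 - lam1 * b21 - lam1 * mu1 * c12 + nu1 * c22"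
definition "p3 = - lam1 * nu1 * b11 + mu1 * b21 - lam1 * mu1 * c11 + (mu1\<^sup>2 + nu1\<^sup>2) * c12 - nu1 * c21"
definition "q1 = (1 - nu2\<^sup>2) * s14 - mu2 * nu2 * t14 - lam2 * nu2 * t15 + lam2 * t24 - mu2 * t25"
definition "q2 = (1 - mu2\<^sup>2) * t14 - mu2 * nu2 * s14 - lam2 * s24 - lam2 * mu2 * t15 + nu2 * t25"
definition "q3 = - lam2 * nu2 * s14 + mu2 * s24 - lam2 * mu2 * t14 + (mu2\<^sup>2 + nu2\<^sup>2) * t15 - nu2 * t24"

text \<open>On \<open>A, B, C, R, S, T\<close> the six vectors form the columns of a skew-symmetric
  matrix. The \<open>p\<close>'s fill one diagonal block, the \<open>q\<close>'s the other, and the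
  mixed entries are combinations of both, so everything vanishes with the \<open>p\<close>'s and
  \<open>q\<close>'s.\<close>

lemma nij_X_comb:
  "nij (comb 0 0 0 0 0 0 1 0) (comb 1 0 0 0 0 0 0 0)
    = comb 0 p1 p2 (lam2 * p3 + lam1 * q3) (- mu2 * p3 - lam1 * q2) (nu2 * p3 + lam1 * q1) 0 0"
  "nij (comb 0 0 0 0 0 0 1 0) (comb 0 1 0 0 0 0 0 0)
    = comb (- p1) 0 p3 (- lam2 * p2 - mu1 * q3) (mu2 * p2 + mu1 * q2) (- nu2 * p2 - mu1 * q1) 0 0"
  "nij (comb 0 0 0 0 0 0 1 0) (comb 0 0 1 0 0 0 0 0)
    = comb (- p2) (- p3) 0 (lam2 * p1 + nu1 * q3) (- mu2 * p1 - nu1 * q2) (nu2 * p1 + nu1 * q1) 0 0"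
  "nij (comb 0 0 0 0 0 0 1 0) (comb 0 0 0 1 0 0 0 0)
    = comb (- lam2 * p3 - lam1 * q3) (lam2 * p2 + mu1 * q3) (- lam2 * p1 - nu1 * q3) 0 q1 q2 0 0"
  "nij (comb 0 0 0 0 0 0 1 0) (comb 0 0 0 0 1 0 0 0)
    = comb (mu2 * p3 + lam1 * q2) (- mu2 * p2 - mu1 * q2) (mu2 * p1 + nu1 * q2) (- q1) 0 q3 0 0"
  "nij (comb 0 0 0 0 0 0 1 0) (comb 0 0 0 0 0 1 0 0)
    = comb (- nu2 * p3 - lam1 * q1) (nu2 * p2 + mu1 * q1) (- nu2 * p1 - nu1 * q1) (- q2) (- q3) 0 0 0"
  unfolding nij_def p1_def p2_def p3_def q1_def q2_def q3_def power2_eq_square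
  by (simp add: br_comb J_comb comb_add comb_diff; rule comb_cong; simp add: algebra_simps unit_rules)+

lemmas nij_X = nij_X_comb[folded base_comb]

text \<open>The vector \<open>(p3, p2, p1)\<close> is orthogonal to \<open>(lam1, mu1, nu1)\<close>,
  and likewise for the \<open>q\<close>'s. As \<open>lam1\<close> and \<open>lam2\<close> are
  nonzero in the theorem, \<open>p3\<close> and \<open>q3\<close> vanish with the other two.\<close>

lemma p3_q3: "lam1 * p3 = - nu1 * p1 - mu1 * p2" "lam2 * q3 = - nu2 * q1 - mu2 * q2"
  unfolding p1_def p2_def p3_def q1_def q2_def q3_def power2_eq_square
  by (simp_all add: algebra_simps unit_rules)

end

text \<open>For unknowns \<open>b\<close> and \<open>c\<close> the coefficient matrix has diagonal
  \<open>1 - n^2\<close>, \<open>1 - m^2\<close> and off-diagonal entries \<open>-m n\<close>. Its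
  determinant is \<open>1 - m^2 - n^2 = l^2\<close>, which is nonzero. It remains to check that the
  displayed values solve the system.\<close>

lemma unit_vector_linear_system:
  fixes l m n b c b' c' u v :: real
  assumes unit: "l\<^sup>2 + m\<^sup>2 + n\<^sup>2 = 1" and l: "l \<noteq> 0"
  shows "(1 - n\<^sup>2) * b - m * n * c - l * n * u + l * c' - m * v = 0 \<and>
      (1 - m\<^sup>2) * c - m * n * b - l * b' - l * m * u + n * v = 0 \<longleftrightarrow>
    c = (l\<^sup>2 + m\<^sup>2) / l * b' + m / l * u - m * n / l * c' - n * v \<and>
    b = m * n / l * b' + n / l * u - (l\<^sup>2 + n\<^sup>2) / l * c' + m * v"
    (is "?P = 0 \<and> ?Q = 0 \<longleftrightarrow> c = ?c \<and> b = ?b")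
proof -
  have ll: "l * l = 1 - m * m - n * n"
    using unit by (simp add: power2_eq_square)
  have "l * (l * z) = (1 - m * m - n * n) * z" for z
    by (simp flip: ll mult.assoc)
  note l2 = ll this
  have lc: "l * ?c = (l\<^sup>2 + m\<^sup>2) * b' + m * u - m * n * c' - l * n * v"
    and lb: "l * ?b = m * n * b' + n * u - (l\<^sup>2 + n\<^sup>2) * c' + l * m * v"
    using l by (simp_all add: field_simps)
  \<comment> \<open>Multiplying by \<open>l\<close> clears the denominators of \<open>?b\<close> and
    \<open>?c\<close>. The outcome is that \<open>?P\<close> is the homogeneous form evaluated at
    the deviations from the claimed solution.\<close>
  have "l * ?P = (1 - n\<^sup>2) * (l * b - l * ?b) - m * n * (l * c - l * ?c)"
    unfolding lb lc by (simp add: power2_eq_square algebra_simps l2)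
  then have "l * ?P = l * ((1 - n\<^sup>2) * (b - ?b) - m * n * (c - ?c))"
    by (simp only: right_diff_distrib mult.left_commute)
  then have P: "?P = (1 - n\<^sup>2) * (b - ?b) - m * n * (c - ?c)"
    using l unfolding mult_cancel_left by blast
  have "l * ?Q = (1 - m\<^sup>2) * (l * c - l * ?c) - m * n * (l * b - l * ?b)"
    unfolding lb lc by (simp add: power2_eq_square algebra_simps l2)
  then have "l * ?Q = l * ((1 - m\<^sup>2) * (c - ?c) - m * n * (b - ?b))"
    by (simp only: right_diff_distrib mult.left_commute)
  then have Q: "?Q = (1 - m\<^sup>2) * (c - ?c) - m * n * (b - ?b)"
    using l unfolding mult_cancel_left by blast
  \<comment> \<open>The adjugate matrix times the coefficient matrix is the determinant times the
    identity.\<close>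
  have det: "(1 - m\<^sup>2) * ((1 - n\<^sup>2) * x - m * n * y) + m * n * ((1 - m\<^sup>2) * y - m * n * x) = l\<^sup>2 * x"
    "(1 - n\<^sup>2) * ((1 - m\<^sup>2) * y - m * n * x) + m * n * ((1 - n\<^sup>2) * x - m * n * y) = l\<^sup>2 * y" for x y
    by (simp_all add: power2_eq_square algebra_simps l2)
  have solve: "f = 0 \<and> h = 0 \<longleftrightarrow> x = 0 \<and> y = 0"
    if "f = (1 - n\<^sup>2) * x - m * n * y" "h = (1 - m\<^sup>2) * y - m * n * x" for f h x y
  proof
    have "(1 - m\<^sup>2) * f + m * n * h = l\<^sup>2 * x" "(1 - n\<^sup>2) * h + m * n * f = l\<^sup>2 * y"
      unfolding that by (rule det)+
    then show "x = 0 \<and> y = 0" if "f = 0 \<and> h = 0"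
      using that l by simp
    show "f = 0 \<and> h = 0" if "x = 0 \<and> y = 0"
      using that \<open>f = _\<close> \<open>h = _\<close> by simp
  qed
  have "?P = 0 \<and> ?Q = 0 \<longleftrightarrow> b - ?b = 0 \<and> c - ?c = 0"
    by (rule solve[OF P Q])
  then show ?thesis
    unfolding right_minus_eq by blast
qed

lemma sum_lessThan_8: "(\<Sum>i<8. f i) = f 0 + f 1 + f 2 + f 3 + f 4 + f 5 + f 6 + f (7::nat)"
  by (simp add: eval_nat_numeral lessThan_Suc add_ac)

section \<open>Integrability as a system of four linear equations\<close>

theorem theorem3p3:
  fixes \<A> :: "('g::{t2_space,second_countable_topology}, real^8) chart set"
    and G :: "'g monoid"
    and g :: "'g \<Rightarrow> ('g, real^8) tangent \<Rightarrow> ('g, real^8) tangent \<Rightarrow> real"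
    and \<Phi> :: "(complex^2^2) \<times> (complex^2^2) \<Rightarrow> 'g"
    and A B C R S T X Y :: "('g, real^8) vfield"
    and J :: "'g \<Rightarrow> ('g, real^8) tangent \<Rightarrow> ('g, real^8) tangent"
    and \<rho> b11 b21 c11 c12 c21 c22 s14 s24 t14 t15 t24 t25 :: real
    and \<theta>1 \<theta>2 \<theta>3 \<theta>4 \<theta>5 \<theta>6 :: real
    and lam1 mu1 nu1 lam2 mu2 nu2 :: real
  assumes G: "riemannian_lie_group \<A> G g"
    and K: "lie_subgroup_inclusion \<A> G (SU2 \<times>\<times> SU2) \<Phi>"
      "carries_killing_metric \<A> G g (SU2 \<times>\<times> SU2) \<Phi>"
    and basis: "orthonormal_basis_of_lie_algebra \<A> G g [A, B, C, R, S, T, X, Y]"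
    and basis_K: "subgroup_lie_algebra \<A> G (SU2 \<times>\<times> SU2) \<Phi> = span {A, B, C, R, S, T}"
    and brackets_K:
      "lie_bracket \<A> A B = 2 *\<^sub>R C" "lie_bracket \<A> B C = 2 *\<^sub>R A" "lie_bracket \<A> C A = 2 *\<^sub>R B"
      "lie_bracket \<A> R S = 2 *\<^sub>R T" "lie_bracket \<A> S T = 2 *\<^sub>R R" "lie_bracket \<A> T R = 2 *\<^sub>R S"
      "\<And>E F. E \<in> {A, B, C} \<Longrightarrow> F \<in> {R, S, T} \<Longrightarrow> lie_bracket \<A> E F = 0"
    and brackets_XY:
      "lie_bracket \<A> A X = - b11 *\<^sub>R B - c11 *\<^sub>R C"
      "lie_bracket \<A> A Y = - b21 *\<^sub>R B - c21 *\<^sub>R C"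
      "lie_bracket \<A> B X = b11 *\<^sub>R A - c12 *\<^sub>R C"
      "lie_bracket \<A> B Y = b21 *\<^sub>R A - c22 *\<^sub>R C"
      "lie_bracket \<A> C X = c11 *\<^sub>R A + c12 *\<^sub>R B"
      "lie_bracket \<A> C Y = c21 *\<^sub>R A + c22 *\<^sub>R B"
      "lie_bracket \<A> R X = - s14 *\<^sub>R S - t14 *\<^sub>R T"
      "lie_bracket \<A> R Y = - s24 *\<^sub>R S - t24 *\<^sub>R T"
      "lie_bracket \<A> S X = s14 *\<^sub>R R - t15 *\<^sub>R T"
      "lie_bracket \<A> S Y = s24 *\<^sub>R R - t25 *\<^sub>R T"
      "lie_bracket \<A> T X = t14 *\<^sub>R R + t15 *\<^sub>R S"
      "lie_bracket \<A> T Y = t24 *\<^sub>R R + t25 *\<^sub>R S"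
      "lie_bracket \<A> X Y = \<rho> *\<^sub>R X + \<theta>1 *\<^sub>R A + \<theta>2 *\<^sub>R B + \<theta>3 *\<^sub>R C
                              + \<theta>4 *\<^sub>R R + \<theta>5 *\<^sub>R S + \<theta>6 *\<^sub>R T"
    and thetas:
      "2 * \<theta>1 = - \<rho> * c12 + b11 * c21 - b21 * c11"
      "2 * \<theta>2 = \<rho> * c11 + b11 * c22 - b21 * c12"
      "2 * \<theta>3 = - \<rho> * b11 + c11 * c22 - c12 * c21"
      "2 * \<theta>4 = - \<rho> * t15 + s14 * t24 - s24 * t14"
      "2 * \<theta>5 = \<rho> * t14 + s14 * t25 - s24 * t15"
      "2 * \<theta>6 = - \<rho> * s14 + t14 * t25 - t15 * t24"
    and units: "lam1\<^sup>2 + mu1\<^sup>2 + nu1\<^sup>2 = 1" "lam2\<^sup>2 + mu2\<^sup>2 + nu2\<^sup>2 = 1"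
    and nonzero: "lam1 \<noteq> 0" "lam2 \<noteq> 0"
    and J: "almost_hermitian \<A> g J" "left_invariant_endo \<A> G J"
      "has_matrix J [A, B, C, R, S, T, X, Y]
        [[0, nu1, mu1, lam1 * lam2, - lam1 * mu2, lam1 * nu2, 0, 0],
         [- nu1, 0, lam1, - mu1 * lam2, mu1 * mu2, - mu1 * nu2, 0, 0],
         [- mu1, - lam1, 0, nu1 * lam2, - nu1 * mu2, nu1 * nu2, 0, 0],
         [- lam1 * lam2, mu1 * lam2, - nu1 * lam2, 0, nu2, mu2, 0, 0],
         [lam1 * mu2, - mu1 * mu2, nu1 * mu2, - nu2, 0, lam2, 0, 0],
         [- lam1 * nu2, mu1 * nu2, - nu1 * nu2, - mu2, - lam2, 0, 0, 0],
         [0, 0, 0, 0, 0, 0, 0, - 1],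
         [0, 0, 0, 0, 0, 0, 1, 0]]"
  shows "integrable_structure \<A> J \<longleftrightarrow>
      c11 = (lam1\<^sup>2 + mu1\<^sup>2) / lam1 * b21 + mu1 / lam1 * c12
            - mu1 * nu1 / lam1 * c21 - nu1 * c22 \<and>
      b11 = mu1 * nu1 / lam1 * b21 + nu1 / lam1 * c12
            - (lam1\<^sup>2 + nu1\<^sup>2) / lam1 * c21 + mu1 * c22 \<and>
      t14 = (lam2\<^sup>2 + mu2\<^sup>2) / lam2 * s24 + mu2 / lam2 * t15
            - mu2 * nu2 / lam2 * t24 - nu2 * t25 \<and>
      s14 = mu2 * nu2 / lam2 * s24 + nu2 / lam2 * t15
            - (lam2\<^sup>2 + nu2\<^sup>2) / lam2 * t24 + mu2 * t25"
proof -
  let ?es = "[A, B, C, R, S, T, X, Y]" and ?B = "{A, B, C, R, S, T, X, Y}"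
  have at: "smooth_atlas \<A>" and g: "riemannian_metric \<A> g"
    using G unfolding riemannian_lie_group_def lie_group_def by auto
  have AC: "almost_complex \<A> J"
    using J(1) unfolding almost_hermitian_def by blast
  have orth: "g p ((?es ! i) p) ((?es ! j) p) = (if i = j then 1 else 0)"
    if "i < length ?es" "j < length ?es" for i j p
    using basis that unfolding orthonormal_basis_of_lie_algebra_def by blast
  have vf: "vector_field \<A> E" if "E \<in> ?B" for E
  proof -
    have "E \<in> span (set ?es)"
      using that by (intro span_base) simp
    then show ?thesis
      using basis unfolding orthonormal_basis_of_lie_algebra_def lie_algebra_def by blast
  qed
  have span_diff: "diff_field \<A> V" if "V \<in> span ?B" for V
    using that
  proof (induction rule: span_induct_alt)
    case base
    show ?case by (rule diff_field_zero[OF at])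
  next
    case (step a E V)
    have "diff_field \<A> (a *\<^sub>R E)"
      unfolding fscale_const[symmetric]
      by (rule diff_field_fscale[OF at diff_fun_const vector_field_imp_diff_field[OF vf[OF step(1)]]])
    then show ?case by (rule diff_field_add[OF at _ step(2)])
  qed
  interpret bracket_table "lie_bracket \<A>" A B C R S T X Y
    \<rho> b11 b21 c11 c12 c21 c22 s14 s24 t14 t15 t24 t25 \<theta>1 \<theta>2 \<theta>3 \<theta>4 \<theta>5 \<theta>6
  proof
    show "lie_bracket \<A> U V = - lie_bracket \<A> V U" for U V
      by (rule lie_bracket_antisym)
    show "lie_bracket \<A> (U + V) W = lie_bracket \<A> U W + lie_bracket \<A> V W"
      if "U \<in> span ?B" "V \<in> span ?B" "W \<in> span ?B" for U V W
      using that by (intro lie_bracket_add_left span_diff)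
    show "lie_bracket \<A> (a *\<^sub>R U) W = a *\<^sub>R lie_bracket \<A> U W"
      if "U \<in> span ?B" "W \<in> span ?B" for a U W
      using that by (intro lie_bracket_scaleR_left[OF at] span_diff)
  qed (fact brackets_K brackets_XY)+
  have es8: "length ?es = 8" by simp
  \<comment> \<open>The matrix is given by rows, whereas the image of the \<open>j\<close>-th basis
    field is read off from the \<open>j\<close>-th column.\<close>
  note col = J(3)[unfolded has_matrix_def es8 sum_lessThan_8, rule_format]
  have J_table:
    "apply_field J A = comb 0 (- nu1) (- mu1) (- lam1 * lam2) (lam1 * mu2) (- lam1 * nu2) 0 0"
    "apply_field J B = comb nu1 0 (- lam1) (mu1 * lam2) (- mu1 * mu2) (mu1 * nu2) 0 0"
    "apply_field J C = comb mu1 lam1 0 (- nu1 * lam2) (nu1 * mu2) (- nu1 * nu2) 0 0"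
    "apply_field J R = comb (lam1 * lam2) (- mu1 * lam2) (nu1 * lam2) 0 (- nu2) (- mu2) 0 0"
    "apply_field J S = comb (- lam1 * mu2) (mu1 * mu2) (- nu1 * mu2) nu2 0 (- lam2) 0 0"
    "apply_field J T = comb (lam1 * nu2) (- mu1 * nu2) (nu1 * nu2) mu2 lam2 0 0 0"
    "apply_field J X = Y" "apply_field J Y = - X"
    using col[of 0] col[of 1] col[of 2] col[of 3] col[of 4] col[of 5] col[of 6] col[of 7]
    by (simp_all add: comb_def)
  interpret tangent_frame \<A> J ?B
  proof
    show "apply_field J V \<in> fun_span \<A> ?B" if "V \<in> ?B" for V
    proof -
      have "- X \<in> span ?B" "Y \<in> span ?B"
        by (auto intro: span_neg span_base)
      then have "apply_field J V \<in> span ?B"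
        using that J_table comb_in_span by auto
      then show ?thesis
        using span_subset_fun_span by blast
    qed
    show "lie_bracket \<A> V W p \<in> tangent_space \<A> p" if "V \<in> ?B" "W \<in> ?B" for V W p
      using span_diff[OF br_in_span[OF that]] by (rule diff_field_tangent)
  qed (use at AC vf vector_field_imp_diff_field in auto)
  have span_fun: "V \<in> fun_span \<A> ?B" if "V \<in> span ?B" for V
    using that span_subset_fun_span by blast
  interpret complex_bracket_table "lie_bracket \<A>" A B C R S T X Y
    \<rho> b11 b21 c11 c12 c21 c22 s14 s24 t14 t15 t24 t25 \<theta>1 \<theta>2 \<theta>3 \<theta>4 \<theta>5 \<theta>6
    "apply_field J" lam1 mu1 nu1 lam2 mu2 nu2
  proof
    show "apply_field J (U + V) = apply_field J U + apply_field J V"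
      if "U \<in> span ?B" "V \<in> span ?B" for U V
      using that by (intro apply_field_add span_fun)
    show "apply_field J (a *\<^sub>R U) = a *\<^sub>R apply_field J U" if "U \<in> span ?B" for a U
      using apply_field_fscale[OF span_fun[OF that], of "\<lambda>_. a"] by (simp only: fscale_const)
  qed (fact J_table units)+
  have nij: "nijenhuis \<A> J U V = nij U V" for U V
    by (simp only: nijenhuis_def nij_def)
  have in_fs: "E \<in> fun_span \<A> ?B" if "E \<in> ?B" for E
    using that by (rule fun_span.base)
  have int_iff: "integrable_structure \<A> J \<longleftrightarrow> (\<forall>E\<in>?B. \<forall>F\<in>?B. nijenhuis \<A> J E F = 0)"
  proof
    assume "integrable_structure \<A> J"
    then show "\<forall>E\<in>?B. \<forall>F\<in>?B. nijenhuis \<A> J E F = 0"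
      unfolding integrable_structure_def by (intro ballI) (simp only: vf)
  next
    assume N: "\<forall>E\<in>?B. \<forall>F\<in>?B. nijenhuis \<A> J E F = 0"
    have fs: "V \<in> fun_span \<A> ?B" if "vector_field \<A> V" for V
    proof -
      have "V \<in> fun_span \<A> (set ?es)"
        by (rule vector_field_in_fun_span[OF at g _ _ orth that]) (simp_all add: vf)
      then show ?thesis by simp
    qed
    then show "integrable_structure \<A> J"
      unfolding integrable_structure_def
    proof (intro allI impI)
      fix E F assume "vector_field \<A> E \<and> vector_field \<A> F"
      then have "E \<in> fun_span \<A> ?B" "F \<in> fun_span \<A> ?B"
        by (simp_all only: fs)
      then show "nijenhuis \<A> J E F = 0"
        by (rule nijenhuis_eq_0[rotated]) (use N in blast)
    qed
  qed
  \<comment> \<open>Evaluated at an arbitrary point, the combination is paired with each basis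
    vector; orthonormality leaves a single coordinate each time.\<close>
  have comb_eq_0: "a = 0 \<and> b = 0 \<and> c = 0 \<and> r = 0 \<and> s = 0 \<and> t = 0 \<and> x = 0 \<and> y = 0"
    if "comb a b c r s t x y = 0" for a b c r s t x y
  proof -
    fix p :: 'g
    let ?a = "[a, b, c, r, s, t, x, y]"
    have scaleR_apply: "(k *\<^sub>R V) p = k *\<^sub>R V p" for k and V :: "('g, real^8) vfield"
      by (simp only: scaleR_fun_def)
    have e: "(?es ! i) p \<in> tangent_space \<A> p" if "i < 8" for i
    proof -
      have "?es ! i \<in> set ?es"
        using that by (intro nth_mem) simp
      then show ?thesis
        using vf unfolding vector_field_def by simp
    qed
    have sum: "(\<Sum>i<8. (?a ! i) *\<^sub>R (?es ! i) p) = 0"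
      using fun_cong[OF that, of p] unfolding comb_def sum_lessThan_8
      by (simp add: vfield_apply scaleR_apply)
    have "?a ! j = 0" if "j < 8" for j
    proof -
      have "(\<Sum>i<8. ?a ! i * g p ((?es ! i) p) ((?es ! j) p)) = g p 0 ((?es ! j) p)"
        unfolding sum[symmetric]
        by (rule riemannian_metric_sum_left[OF at g, symmetric]) (use e that in auto)
      also have "g p 0 ((?es ! j) p) = 0"
        using riemannian_metric_sum_left[OF at g, of "{}"] e[OF that] by simp
      also have "(\<Sum>i<8. ?a ! i * g p ((?es ! i) p) ((?es ! j) p)) = (\<Sum>i<8. if i = j then ?a ! i else 0)"
        using orth that by (intro sum.cong) auto
      finally show ?thesis using that by simp
    qed
    from this[of 0] this[of 1] this[of 2] this[of 3] this[of 4] this[of 5] this[of 6] this[of 7]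
    show ?thesis by simp
  qed
  have J_zero: "apply_field J 0 = 0"
    using J_scale[OF span_zero, of 0] by simp
  have anti: "nij E F = - nij F E" if "E \<in> ?B" "F \<in> ?B" for E F
    unfolding nij[symmetric] using that by (intro nijenhuis_antisym in_fs)
  have swap: "nij E F = 0" if "nij F E = 0" "E \<in> ?B" "F \<in> ?B" for E F
    using anti[OF that(2,3)] that(1) by simp
  have "integrable_structure \<A> J \<longleftrightarrow> (p1 = 0 \<and> p2 = 0) \<and> q1 = 0 \<and> q2 = 0"
  proof
    assume "integrable_structure \<A> J"
    then have N: "nij E F = 0" if "E \<in> ?B" "F \<in> ?B" for E F
      using int_iff that unfolding nij by blast
    \<comment> \<open>Two vectors suffice: \<open>p1\<close>, \<open>p2\<close> are coordinates of
      \<open>nij X A\<close>, and \<open>q1\<close>, \<open>q2\<close> are coordinates of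
      \<open>nij X R\<close>.\<close>
    have "nij X A = 0" "nij X R = 0"
      by (rule N; simp)+
    then show "(p1 = 0 \<and> p2 = 0) \<and> q1 = 0 \<and> q2 = 0"
      using comb_eq_0 unfolding nij_X by blast
  next
    assume pq: "(p1 = 0 \<and> p2 = 0) \<and> q1 = 0 \<and> q2 = 0"
    then have "p3 = 0" "q3 = 0"
      using p3_q3 nonzero by simp_all
    then have XK: "nij X A = 0" "nij X B = 0" "nij X C = 0" "nij X R = 0" "nij X S = 0" "nij X T = 0"
      using pq by (simp_all add: nij_X comb_zero)
    have self: "nij E E = 0" if "E \<in> ?B" for E
      using anti[OF that that] by (rule eq_uminus_imp_zero)
    have Y: "nij Y E = - apply_field J (nij X E)" if "E \<in> ?B" for E
      using nijenhuis_J_left[OF in_fs in_fs[OF that], of X] J_table(7) by (simp add: nij)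
    \<comment> \<open>Since \<open>Y = JX\<close>, this is \<open>-J\<close> applied to
      \<open>nij X X\<close>, which is zero by skewness.\<close>
    have "nij Y X = 0"
      using Y[of X] self[of X] J_zero by simp
    then have "nij X Y = 0"
      by (rule swap) simp_all
    then have XB: "nij X E = 0" if "E \<in> ?B" for E
      using that XK self[of X] by blast
    then have YB: "nij Y E = 0" if "E \<in> ?B" for E
      using that Y J_zero by simp
    have K: "nij E F = 0" if "E \<in> {A, B, C, R, S, T}" "F \<in> {A, B, C, R, S, T}" for E F
    proof -
      have B: "E \<in> ?B" "F \<in> ?B"
        using that by auto
      \<comment> \<open>The fifteen identities \<open>nij_compact\<close> cover every unordered pair
        of distinct vectors among the six.\<close>
      have "E = F \<or> nij E F = 0 \<or> nij F E = 0"
        using that nij_compact by blast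
      then show ?thesis
        using self[OF B(1)] swap[OF _ B] by blast
    qed
    have "nij E F = 0" if "E \<in> ?B" "F \<in> ?B" for E F
    proof -
      have "nij E X = 0"
        using XB[OF that(1)] by (rule swap) (use that in simp_all)
      moreover have "nij E Y = 0"
        using YB[OF that(1)] by (rule swap) (use that in simp_all)
      ultimately show ?thesis
        using that XB YB K by blast
    qed
    then show "integrable_structure \<A> J"
      unfolding int_iff nij by blast
  qed
  then show ?thesis
    unfolding p1_def p2_def q1_def q2_def
      unit_vector_linear_system[OF units(1) nonzero(1)] unit_vector_linear_system[OF units(2) nonzero(2)]
    by blast
qed

end
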